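(* Let $H,K$ be Hilbert spaces and let $\mathcal{S}\subseteq B(H)$, $\mathcal{T}\subseteq B(K)$ be strongly TRO-equivalent operator systems. Then there exists a unitary operator $U\in B(H\otimes\ell^2,K\otimes\ell^2)$ such that $$\mathcal{T}\otimes\mathcal{K}=U(\mathcal{S}\otimes\mathcal{K})U^*.$$
   Context: A (concrete) operator system in $B(H)$ is a norm-closed self-adjoint subspace containing $I_H$. A ternary ring of operators (TRO) is a subspace $\mathcal{M}\subseteq B(H,K)$ with $\mathcal{M}\mathcal{M}^*\mathcal{M}\subseteq\mathcal{M}$. $[\,\cdot\,]^{-\|\cdot\|}$ denotes norm-closed linear span. Concrete operator systems $\mathcal{S}\subseteq B(H)$, $\mathcal{T}\subseteq B(K)$ are strongly TRO-equivalent if there is a TRO $\mathcal{M}\subseteq B(H,K)$ with $I_H\in[\mathcal{M}^*\mathcal{M}]^{-\|\cdot\|}$, $I_K\in[\mathcal{M}\mathcal{M}^*]^{-\|\cdot\|}$, $\mathcal{M}\mathcal{S}\mathcal{M}^*\subseteq\mathcal{T}$ and $\mathcal{M}^*\mathcal{T}\mathcal{M}\subseteq\mathcal{S}$. (Equivalently, there is a norm-closed TRO $\mathcal{M}$ with $\mathcal{T}=[\mathcal{M}\mathcal{S}\mathcal{M}^*]^{-\|\cdot\|}$ and $\mathcal{S}=[\mathcal{M}^*\mathcal{T}\mathcal{M}]^{-\|\cdot\|}$.) $\mathcal{K}$ is the algebra of compact operators on $\ell^2=\ell^2(\mathbb{N})$, and $\mathcal{S}\otimes\mathcal{K}$ is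 the norm-closed linear span in $B(H\otimes\ell^2)$ of the operators $s\otimes k$, $s\in\mathcal{S}$, $k\in\mathcal{K}$. *)

theory Defs
  imports "HOL-Analysis.Analysis"
begin

section \<open>Complex Hilbert spaces\<close>

class scaleC =
  fixes scaleC :: "complex \<Rightarrow> 'a \<Rightarrow> 'a" (infixr "*\<^sub>C" 75)

class complex_vector = real_vector + scaleC +
  assumes scaleC_add_right: "c *\<^sub>C (x + y) = c *\<^sub>C x + c *\<^sub>C y"
    and scaleC_add_left: "(c + d) *\<^sub>C x = c *\<^sub>C x + d *\<^sub>C x"
    and scaleC_scaleC [simp]: "c *\<^sub>C d *\<^sub>C x = (c * d) *\<^sub>C x"
    and scaleR_scaleC: "r *\<^sub>R x = complex_of_real r *\<^sub>C x"
begin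

lemma scaleC_one [simp]: "1 *\<^sub>C x = x"
  using scaleR_scaleC [of 1 x] scaleR_one [of x] by simp

end

global_interpretation complex_vector: vector_space "scaleC :: complex \<Rightarrow> 'a \<Rightarrow> 'a::complex_vector"
  by unfold_locales (simp_all add: scaleC_add_right scaleC_add_left)

text \<open>The underlying real inner product of \<^class>\<open>real_inner\<close> is the real part of the complex
  one, so norm and topology are those of the complex inner product. The complex inner product is
  conjugate-linear in its first argument.\<close>

class complex_inner = complex_vector + real_inner +
  fixes cinner :: "'a \<Rightarrow> 'a \<Rightarrow> complex"
  assumes cinner_commute: "cinner x y = cnj (cinner y x)"
    and cinner_add_right: "cinner x (y + z) = cinner x y + cinner x z"
    and cinner_scaleC_right [simp]: "cinner x (c *\<^sub>C y) = c * cinner x y"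
    and inner_eq_Re_cinner: "inner x y = Re (cinner x y)"

class chilbert_space = complex_inner + complete_space

subclass (in chilbert_space) banach ..

lemma cinner_add_left: "cinner (x + y) z = cinner x z + cinner y z"
  by (metis cinner_add_right cinner_commute complex_cnj_add)

lemma cinner_scaleC_left [simp]: "cinner (c *\<^sub>C x) y = cnj c * cinner x y"
  by (metis cinner_commute cinner_scaleC_right complex_cnj_mult)

lemma cinner_self: "cinner x x = complex_of_real ((norm x)\<^sup>2)"
proof -
  have "Im (cinner x x) = 0"
    using arg_cong [OF cinner_commute [of x x], of Im] by simp
  moreover have "Re (cinner x x) = (norm x)\<^sup>2"
    by (simp add: inner_eq_Re_cinner [symmetric] power2_norm_eq_inner)
  ultimately show ?thesis by (simp add: complex_eq_iff)
qed

lemma cinner_sum_right: "cinner x (\<Sum>i\<in>I. f i) = (\<Sum>i\<in>I. cinner x (f i))"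
proof -
  have "Modules.additive (cinner x)" by unfold_locales (rule cinner_add_right)
  from Modules.additive.sum [OF this] show ?thesis .
qed

lemma cinner_sum_left: "cinner (\<Sum>i\<in>I. f i) x = (\<Sum>i\<in>I. cinner (f i) x)"
  by (subst cinner_commute) (simp add: cinner_sum_right cinner_commute [symmetric])

lemma cinner_zero_right [simp]: "cinner x 0 = 0"
  using cinner_sum_right [of x "\<lambda>_. 0" "{}"] by simp

lemma cinner_zero_left [simp]: "cinner 0 x = 0"
  by (subst cinner_commute) simp

lemma cinner_diff_right: "cinner x (y - z) = cinner x y - cinner x z"
  using cinner_add_right [of x "y - z" z] by simp

lemma cinner_diff_left: "cinner (y - z) x = cinner y x - cinner z x"
  using cinner_add_left [of "y - z" z x] by simp

lemma cinner_ext: "(\<And>x. cinner x y = cinner x z) \<Longrightarrow> y = z"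
  by (metis all_zero_iff inner_commute inner_diff_right inner_eq_Re_cinner right_minus_eq)

lemma norm_scaleC [simp]: "norm (c *\<^sub>C x) = cmod c * norm x" for x :: "'a::complex_inner"
proof -
  have "complex_of_real ((norm (c *\<^sub>C x))\<^sup>2) = cnj c * (c * complex_of_real ((norm x)\<^sup>2))"
    by (simp only: cinner_self [symmetric] cinner_scaleC_left cinner_scaleC_right mult.left_commute)
  also have "\<dots> = complex_of_real ((cmod c * norm x)\<^sup>2)"
    by (simp add: power_mult_distrib complex_norm_square mult_ac del: of_real_power)
  finally have "(norm (c *\<^sub>C x))\<^sup>2 = (cmod c * norm x)\<^sup>2"
    by (simp only: of_real_eq_iff)
  then show ?thesis by (simp add: power2_eq_iff_nonneg)
qed

lemma norm_cinner_le: "cmod (cinner x y) \<le> norm x * norm y"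
proof (cases "cinner x y = 0")
  case False
  define c where "c = cnj (sgn (cinner x y))"
  have c: "cmod c = 1" using False by (simp add: c_def norm_sgn)
  have "c * cinner x y = complex_of_real (cmod (cinner x y))"
    by (simp add: c_def sgn_div_norm scaleR_conv_of_real complex_norm_square
        [symmetric] power2_eq_square field_simps False mult.commute [of "cnj _"])
  then have "cmod (cinner x y) = Re (cinner x (c *\<^sub>C y))" by simp
  also have "\<dots> \<le> norm x * norm (c *\<^sub>C y)"
    using norm_cauchy_schwarz [of x "c *\<^sub>C y"] by (simp only: inner_eq_Re_cinner)
  finally show ?thesis by (simp add: c)
qed simp

instantiation complex :: chilbert_space
begin

definition scaleC_complex :: "complex \<Rightarrow> complex \<Rightarrow> complex"
  where [simp]: "scaleC_complex c x = c * x"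

definition cinner_complex :: "complex \<Rightarrow> complex \<Rightarrow> complex"
  where "cinner_complex x y = cnj x * y"

instance
  by standard (auto simp: algebra_simps scaleR_conv_of_real cinner_complex_def inner_complex_def)

end


section \<open>Bounded operators\<close>

text \<open>Elements of \<^typ>\<open>'a \<Rightarrow>\<^sub>L 'b\<close> are only real-linear; \<open>cblinfun\<close> is the space of bounded
  complex-linear operators.\<close>

definition cblinfun :: "('a::complex_inner \<Rightarrow>\<^sub>L 'b::complex_inner) set"
  where "cblinfun = {T :: 'a \<Rightarrow>\<^sub>L 'b. \<forall>c x. T (c *\<^sub>C x) = c *\<^sub>C T x}"

lemma bounded_linear_scaleC: "bounded_linear (\<lambda>x::'a::complex_inner. c *\<^sub>C x)"
  by (rule bounded_linear_intro [of _ "cmod c"])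
    (simp_all add: scaleC_add_right scaleR_scaleC mult.commute)

instantiation blinfun :: (real_normed_vector, complex_inner) complex_vector
begin

lift_definition scaleC_blinfun :: "complex \<Rightarrow> 'a \<Rightarrow>\<^sub>L 'b \<Rightarrow> 'a \<Rightarrow>\<^sub>L 'b" is "\<lambda>c f x. c *\<^sub>C f x"
  by (rule bounded_linear_compose [OF bounded_linear_scaleC])

instance
  by standard (transfer; simp add: scaleC_add_right scaleC_add_left scaleR_scaleC fun_eq_iff)+

end

text \<open>Well defined on \<open>cblinfun\<close>, by lemma \<open>adj\<close> below.\<close>

definition adj :: "('a::chilbert_space \<Rightarrow>\<^sub>L 'b::chilbert_space) \<Rightarrow> 'b \<Rightarrow>\<^sub>L 'a"
  where "adj T = (THE A :: 'b \<Rightarrow>\<^sub>L 'a. \<forall>x y. cinner (T x) y = cinner x (A y))"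

lemma riesz:
  fixes \<phi> :: "'a::{real_inner, complete_space} \<Rightarrow> real"
  assumes "bounded_linear \<phi>"
  shows "\<exists>z. \<forall>x. \<phi> x = inner z x"
proof -
  interpret bounded_linear \<phi> by fact
  obtain N where N: "\<And>x. \<bar>\<phi> x\<bar> \<le> norm x * N" using bounded by (auto simp: real_norm_def)
  define J where "J x = (norm x)\<^sup>2 - 2 * \<phi> x" for x
  have lower: "- N\<^sup>2 \<le> J x" for x
  proof -
    have "0 \<le> (norm x - N)\<^sup>2" by simp
    then show ?thesis using N [of x] by (simp add: J_def power2_diff)
  qed
  define m where "m = (INF x. J x)"
  have bdd: "bdd_below (range J)" by (rule bdd_belowI2 [OF lower])
  have m: "m \<le> J x" for x unfolding m_def by (rule cINF_lower [OF bdd]) simp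
  have par: "(norm (x - y))\<^sup>2 \<le> 2 * (J x - m) + 2 * (J y - m)" for x y
  proof -
    have "(norm (x - y))\<^sup>2 = 2 * J x + 2 * J y - 4 * J ((1/2) *\<^sub>R (x + y))"
      by (simp add: J_def power2_norm_eq_inner scaleR add inner_add_left inner_add_right
        inner_diff_left inner_diff_right inner_commute field_simps)
    with m [of "(1/2) *\<^sub>R (x + y)"] show ?thesis by simp
  qed
  have "\<exists>x. J x < m + e" if "e > 0" for e
    using that cINF_less_iff [OF _ bdd, of "m + e"] by (auto simp: m_def)
  then have "\<forall>n. \<exists>x. J x < m + inverse (real (Suc n))" by simp
  then obtain u where u: "\<And>n. J (u n) < m + inverse (real (Suc n))" by metis
  have "Cauchy u"
  proof (rule CauchyI)
    fix e :: real assume e: "e > 0"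
    then obtain n0 where n0: "inverse (real (Suc n0)) < e\<^sup>2 / 4"
      using reals_Archimedean [of "e\<^sup>2 / 4"] by auto
    have *: "J (u n) - m < e\<^sup>2 / 4" if "n \<ge> n0" for n
  proof -
      have "inverse (real (Suc n)) \<le> inverse (real (Suc n0))"
        using that by (intro le_imp_inverse_le) simp_all
      then show ?thesis using u [of n] n0 by linarith
    qed
    have "norm (u i - u j) < e" if "i \<ge> n0" "j \<ge> n0" for i j
    proof -
      have "(norm (u i - u j))\<^sup>2 < e\<^sup>2"
        using par [of "u i" "u j"] * [OF that(1)] * [OF that(2)] by simp
      then show ?thesis using e by (simp add: power_less_imp_less_base)
    qed
    then show "\<exists>M. \<forall>i\<ge>M. \<forall>j\<ge>M. norm (u i - u j) < e" by blast
  qed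
  then obtain z where z: "u \<longlonglongrightarrow> z" using Cauchy_convergent convergent_def by blast
  have "(\<lambda>n. J (u n)) \<longlonglongrightarrow> J z"
    unfolding J_def by (intro tendsto_intros z tendsto)
  moreover have "(\<lambda>n. m + inverse (real (Suc n))) \<longlonglongrightarrow> m + 0"
    by (intro tendsto_intros LIMSEQ_inverse_real_of_nat)
  ultimately have "J z \<le> m + 0"
    by (rule LIMSEQ_le) (use u in \<open>auto intro: less_imp_le\<close>)
  then have Jz: "J z \<le> m" by simp
  have "\<phi> x = inner z x" for x
  proof -
    define d where "d = inner z x - \<phi> x"
    have q: "0 \<le> 2 * t * d + t\<^sup>2 * (norm x)\<^sup>2" for t
    proof -
      have "J (z + t *\<^sub>R x) = J z + 2 * t * d + t\<^sup>2 * (norm x)\<^sup>2"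
        by (simp add: J_def d_def power2_norm_eq_inner add scaleR inner_add_left inner_add_right
          inner_commute distrib_left right_diff_distrib) (simp add: power2_eq_square mult_ac)
      with m [of "z + t *\<^sub>R x"] Jz show ?thesis by simp
    qed
    have "d = 0"
    proof (rule ccontr)
      assume d: "d \<noteq> 0"
      define s where "s = (norm x)\<^sup>2 + 1"
      have s: "s > 0" by (simp add: s_def add_nonneg_pos)
      define t where "t = - d / s"
      have ts: "t * s = - d" using s by (simp add: t_def)
      have "0 \<le> 2 * t * d + t\<^sup>2 * (norm x)\<^sup>2" by (rule q)
      also have "\<dots> \<le> 2 * t * d + t\<^sup>2 * s"
        by (intro add_left_mono mult_left_mono) (simp_all add: s_def)
      also have "t\<^sup>2 * s = t * (t * s)" by (simp only: power2_eq_square mult.assoc)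
      also have "2 * t * d + t * (t * s) = t * d" by (simp add: ts)
      also have "t * d = - (d\<^sup>2 / s)" by (simp add: t_def power2_eq_square)
      also have "\<dots> < 0" using s d by simp
      finally show False by simp
    qed
    then show ?thesis by (simp add: d_def)
  qed
  then show ?thesis by blast
qed

lemma adj_ex:
  fixes T :: "'a::chilbert_space \<Rightarrow>\<^sub>L 'b::chilbert_space"
  assumes "T \<in> cblinfun"
  shows "\<exists>A\<in>cblinfun. \<forall>x y. cinner (T x) y = cinner x (A y)"
proof -
  have T: "T (c *\<^sub>C x) = c *\<^sub>C T x" for c x using assms by (auto simp: cblinfun_def)
  have "\<exists>z. \<forall>x. inner y (T x) = inner z x" for y
    by (rule riesz) (intro bounded_linear_compose [OF bounded_linear_inner_right]
      blinfun.bounded_linear_right)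
  then obtain A where A: "\<And>y x. inner y (T x) = inner (A y) x" by metis
  have Re: "Re (cinner (T x) y) = Re (cinner x (A y))" for x y
    using A [of y x] by (simp add: inner_eq_Re_cinner [symmetric] inner_commute)
  have cA: "cinner (T x) y = cinner x (A y)" for x y
  proof (rule complex_eqI)
    show "Im (cinner (T x) y) = Im (cinner x (A y))"
      using Re [of "\<i> *\<^sub>C x" y] by (simp add: T)
  qed (rule Re)
  have add: "A (x + y) = A x + A y" for x y
    by (rule cinner_ext) (simp add: cA [symmetric] cinner_add_right)
  have sc: "A (c *\<^sub>C x) = c *\<^sub>C A x" for c x
    by (rule cinner_ext) (simp add: cA [symmetric])
  have bd: "norm (A y) \<le> norm y * norm T" for y
  proof -
    have "(norm (A y))\<^sup>2 = inner y (T (A y))" by (simp add: A power2_norm_eq_inner)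
    also have "\<dots> \<le> norm y * norm (T (A y))" by (rule norm_cauchy_schwarz)
    also have "\<dots> \<le> norm y * (norm T * norm (A y))" by (intro mult_left_mono norm_blinfun) simp
    finally have "norm (A y) * norm (A y) \<le> (norm y * norm T) * norm (A y)"
      by (simp add: power2_eq_square mult_ac)
    then show ?thesis by (cases "A y = 0") simp_all
  qed
  have "bounded_linear A"
    by (rule bounded_linear_intro [OF add _ bd]) (simp add: scaleR_scaleC sc)
  then show ?thesis using cA sc
    by (intro bexI [of _ "Blinfun A"]) (simp_all add: cblinfun_def bounded_linear_Blinfun_apply)
qed

lemma adj:
  fixes T :: "'a::chilbert_space \<Rightarrow>\<^sub>L 'b::chilbert_space"
  assumes "T \<in> cblinfun"
  shows "adj T \<in> cblinfun" and "cinner (T x) y = cinner x (adj T y)"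
proof -
  obtain A where A: "A \<in> cblinfun" "\<forall>x y. cinner (T x) y = cinner x (A y)"
    by (rule bexE [OF adj_ex [OF assms]])
  have "adj T = A"
    unfolding adj_def
  proof (rule the_equality)
    fix B :: "'b \<Rightarrow>\<^sub>L 'a" assume B: "\<forall>x y. cinner (T x) y = cinner x (B y)"
    show "B = A"
      by (rule blinfun_eqI, rule cinner_ext) (metis A(2) B)
  qed (rule A(2))
  then show "adj T \<in> cblinfun" "cinner (T x) y = cinner x (adj T y)" using A(1) A(2) [rule_format] by simp_all
qed

definition unitary :: "('a::chilbert_space \<Rightarrow>\<^sub>L 'b::chilbert_space) \<Rightarrow> bool"
  where "unitary U \<longleftrightarrow> U \<in> cblinfun \<and> adj U o\<^sub>L U = id_blinfun \<and> U o\<^sub>L adj U = id_blinfun"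

definition compact_op :: "('a::chilbert_space \<Rightarrow>\<^sub>L 'b::chilbert_space) \<Rightarrow> bool"
  where "compact_op T \<longleftrightarrow> T \<in> cblinfun \<and> compact (closure (T ` cball 0 1))"

definition closed_cspan :: "('a::chilbert_space \<Rightarrow>\<^sub>L 'b::chilbert_space) set \<Rightarrow> ('a \<Rightarrow>\<^sub>L 'b) set"
  where "closed_cspan A = closure (complex_vector.span A)"


section \<open>Operator systems and strong TRO-equivalence\<close>

definition operator_system :: "('a::chilbert_space \<Rightarrow>\<^sub>L 'a) set \<Rightarrow> bool"
  where "operator_system S \<longleftrightarrow> S \<subseteq> cblinfun \<and> complex_vector.subspace S \<and> closed S \<and>
    (\<forall>s\<in>S. adj s \<in> S) \<and> id_blinfun \<in> S"

definition TRO :: "('a::chilbert_space \<Rightarrow>\<^sub>L 'b::chilbert_space) set \<Rightarrow> bool"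
  where "TRO M \<longleftrightarrow> M \<subseteq> cblinfun \<and> complex_vector.subspace M \<and>
    (\<forall>a\<in>M. \<forall>b\<in>M. \<forall>c\<in>M. a o\<^sub>L adj b o\<^sub>L c \<in> M)"

definition strongly_TRO_equivalent ::
    "('a::chilbert_space \<Rightarrow>\<^sub>L 'a) set \<Rightarrow> ('b::chilbert_space \<Rightarrow>\<^sub>L 'b) set \<Rightarrow> bool"
  where "strongly_TRO_equivalent S T \<longleftrightarrow> (\<exists>M :: ('a \<Rightarrow>\<^sub>L 'b) set. TRO M \<and>
    id_blinfun \<in> closed_cspan {adj a o\<^sub>L b | a b. a \<in> M \<and> b \<in> M} \<and>
    id_blinfun \<in> closed_cspan {a o\<^sub>L adj b | a b. a \<in> M \<and> b \<in> M} \<and>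
    (\<forall>a\<in>M. \<forall>s\<in>S. \<forall>b\<in>M. a o\<^sub>L s o\<^sub>L adj b \<in> T) \<and>
    (\<forall>a\<in>M. \<forall>t\<in>T. \<forall>b\<in>M. adj a o\<^sub>L t o\<^sub>L b \<in> S))"


section \<open>The Hilbert space \<open>H \<otimes> \<ell>\<^sup>2\<close>\<close>

text \<open>\<open>'a ell2\<close> is the space of square-summable sequences in \<^typ>\<open>'a\<close>. Thus \<open>\<ell>\<^sup>2\<close> is
  \<open>complex ell2\<close>, and \<open>H \<otimes> \<ell>\<^sup>2\<close> is realised as \<open>H ell2\<close>, with \<open>h \<otimes> \<xi>\<close> the sequence
  \<open>n \<mapsto> \<xi>\<^sub>n h\<close>; the map \<open>(h, \<xi>) \<mapsto> h \<otimes> \<xi>\<close> is bilinear, satisfies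
  \<open>\<langle>h \<otimes> \<xi>, h' \<otimes> \<xi>'\<rangle> = \<langle>h, h'\<rangle> \<langle>\<xi>, \<xi>'\<rangle>\<close>, and its range has dense linear span.\<close>

typedef (overloaded) 'a::complex_inner ell2 = "{f :: nat \<Rightarrow> 'a. summable (\<lambda>n. (norm (f n))\<^sup>2)}"
  morphisms ell2_nth Abs_ell2
  by (rule exI [of _ "\<lambda>_. 0"]) simp

setup_lifting type_definition_ell2

lemma summable_ell2: "summable (\<lambda>n. (norm (ell2_nth x n))\<^sup>2)"
  using ell2_nth [of x] by simp

lemma ell2_eqI: "(\<And>n. ell2_nth x n = ell2_nth y n) \<Longrightarrow> x = y"
  by (simp add: ell2_nth_inject [symmetric] fun_eq_iff)

lemma summable_norm2_add:
  fixes f g :: "nat \<Rightarrow> 'a::real_normed_vector"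
  assumes "summable (\<lambda>n. (norm (f n))\<^sup>2)" "summable (\<lambda>n. (norm (g n))\<^sup>2)"
  shows "summable (\<lambda>n. (norm (f n + g n))\<^sup>2)"
proof (rule summable_comparison_test')
  show "summable (\<lambda>n. 2 * (norm (f n))\<^sup>2 + 2 * (norm (g n))\<^sup>2)"
    by (intro summable_add summable_mult assms)
  fix n
  have "(norm (f n + g n))\<^sup>2 \<le> (norm (f n) + norm (g n))\<^sup>2"
    by (intro power_mono norm_triangle_ineq) simp
  also have "\<dots> \<le> 2 * (norm (f n))\<^sup>2 + 2 * (norm (g n))\<^sup>2"
    using sum_squares_bound [of "norm (f n)" "norm (g n)"] by (simp add: power2_sum)
  finally show "norm ((norm (f n + g n))\<^sup>2) \<le> 2 * (norm (f n))\<^sup>2 + 2 * (norm (g n))\<^sup>2" by simp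
qed

lemma summable_cmod_mult:
  fixes f :: "nat \<Rightarrow> 'a::real_normed_vector" and g :: "nat \<Rightarrow> 'b::real_normed_vector"
  assumes "summable (\<lambda>n. (norm (f n))\<^sup>2)" "summable (\<lambda>n. (norm (g n))\<^sup>2)"
  shows "summable (\<lambda>n. norm (f n) * norm (g n))"
proof (rule summable_comparison_test')
  show "summable (\<lambda>n. (norm (f n))\<^sup>2 + (norm (g n))\<^sup>2)" by (intro summable_add assms)
  show "norm (norm (f n) * norm (g n)) \<le> (norm (f n))\<^sup>2 + (norm (g n))\<^sup>2" for n
  proof -
    have "0 \<le> norm (f n) * norm (g n)" by simp
    then have "norm (f n) * norm (g n) \<le> (norm (f n))\<^sup>2 + (norm (g n))\<^sup>2"
      using sum_squares_bound [of "norm (f n)" "norm (g n)"] unfolding mult.assoc by linarith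
    then show ?thesis by simp
  qed
qed

instantiation ell2 :: (complex_inner) complex_inner
begin

lift_definition zero_ell2 :: "'a ell2" is "\<lambda>_. 0" by simp
lift_definition plus_ell2 :: "'a ell2 \<Rightarrow> 'a ell2 \<Rightarrow> 'a ell2" is "\<lambda>f g n. f n + g n"
  by (rule summable_norm2_add)
lift_definition uminus_ell2 :: "'a ell2 \<Rightarrow> 'a ell2" is "\<lambda>f n. - f n" by simp
lift_definition minus_ell2 :: "'a ell2 \<Rightarrow> 'a ell2 \<Rightarrow> 'a ell2" is "\<lambda>f g n. f n - g n"
  subgoal for f g using summable_norm2_add [of f "\<lambda>n. - g n"] by simp
  done
lift_definition scaleC_ell2 :: "complex \<Rightarrow> 'a ell2 \<Rightarrow> 'a ell2" is "\<lambda>c f n. c *\<^sub>C f n"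
  by (simp add: power_mult_distrib summable_mult)
lift_definition scaleR_ell2 :: "real \<Rightarrow> 'a ell2 \<Rightarrow> 'a ell2" is "\<lambda>r f n. r *\<^sub>R f n"
  by (simp add: power_mult_distrib summable_mult)

definition cinner_ell2 :: "'a ell2 \<Rightarrow> 'a ell2 \<Rightarrow> complex"
  where "cinner_ell2 x y = (\<Sum>n. cinner (ell2_nth x n) (ell2_nth y n))"
definition inner_ell2 :: "'a ell2 \<Rightarrow> 'a ell2 \<Rightarrow> real"
  where "inner_ell2 x y = Re (cinner x y)"
definition norm_ell2 :: "'a ell2 \<Rightarrow> real"
  where "norm_ell2 x = sqrt (inner x x)"
definition dist_ell2 :: "'a ell2 \<Rightarrow> 'a ell2 \<Rightarrow> real"
  where "dist_ell2 x y = norm (x - y)"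
definition sgn_ell2 :: "'a ell2 \<Rightarrow> 'a ell2"
  where "sgn_ell2 x = inverse (norm x) *\<^sub>R x"
definition uniformity_ell2 :: "('a ell2 \<times> 'a ell2) filter"
  where "uniformity_ell2 = (INF e\<in>{0<..}. principal {(x, y). dist x y < e})"
definition open_ell2 :: "'a ell2 set \<Rightarrow> bool"
  where "open_ell2 U \<longleftrightarrow> (\<forall>x\<in>U. \<forall>\<^sub>F (x', y) in uniformity. x' = x \<longrightarrow> y \<in> U)"

lemma summable_cinner_ell2: "summable (\<lambda>n. cinner (ell2_nth x n) (ell2_nth y n))"
  by (rule summable_comparison_test' [OF summable_cmod_mult [OF summable_ell2 summable_ell2]])
    (rule norm_cinner_le)

instance
proof
  fix x y z :: "'a ell2" and r s :: real and c d :: complex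
  show "x + y + z = x + (y + z)" "x + y = y + x" "0 + x = x" "- x + x = 0" "x - y = x + - y"
    by (transfer; simp add: add_ac)+
  show "r *\<^sub>R (x + y) = r *\<^sub>R x + r *\<^sub>R y" "(r + s) *\<^sub>R x = r *\<^sub>R x + s *\<^sub>R x"
    "r *\<^sub>R s *\<^sub>R x = (r * s) *\<^sub>R x" "1 *\<^sub>R x = x"
    by (transfer; simp add: scaleR_add_left scaleR_add_right)+
  show "c *\<^sub>C (x + y) = c *\<^sub>C x + c *\<^sub>C y" "(c + d) *\<^sub>C x = c *\<^sub>C x + d *\<^sub>C x"
    "c *\<^sub>C d *\<^sub>C x = (c * d) *\<^sub>C x" "r *\<^sub>R x = complex_of_real r *\<^sub>C x"
    by (transfer; simp add: scaleC_add_left scaleC_add_right scaleR_scaleC)+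
  show "dist x y = norm (x - y)" by (rule dist_ell2_def)
  show "sgn x = inverse (norm x) *\<^sub>R x" by (rule sgn_ell2_def)
  show "uniformity = (INF e\<in>{0<..}. principal {(x :: 'a ell2, y). dist x y < e})"
    by (rule uniformity_ell2_def)
  show "open U \<longleftrightarrow> (\<forall>x\<in>U. \<forall>\<^sub>F (x', y) in uniformity. x' = x \<longrightarrow> y \<in> U)" for U :: "'a ell2 set"
    by (rule open_ell2_def)
  show comm: "cinner x y = cnj (cinner y x)" for x y :: "'a ell2"
    unfolding cinner_ell2_def
    by (subst bounded_linear.suminf [OF bounded_linear_cnj summable_cinner_ell2])
      (simp add: cinner_commute [symmetric])
  show add: "cinner x (y + z) = cinner x y + cinner x z" for x y z :: "'a ell2"
    by (simp add: cinner_ell2_def plus_ell2.rep_eq cinner_add_right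
      suminf_add [OF summable_cinner_ell2 summable_cinner_ell2])
  show sc: "cinner x (c *\<^sub>C y) = c * cinner x y" for x y :: "'a ell2" and c
    by (simp add: cinner_ell2_def scaleC_ell2.rep_eq suminf_mult [OF summable_cinner_ell2])
  show "inner x y = Re (cinner x y)" for x y :: "'a ell2" by (rule inner_ell2_def)
  show "inner x y = inner y x" by (simp add: inner_ell2_def comm [of x y])
  show "inner (x + y) z = inner x z + inner y z"
    by (simp add: inner_ell2_def comm [of _ z] add)
  have "r *\<^sub>R x = complex_of_real r *\<^sub>C x" by transfer (simp add: scaleR_scaleC)
  then show "inner (r *\<^sub>R x) y = r * inner x y"
    by (simp add: inner_ell2_def comm [of _ y] sc)
  have eq: "inner x x = (\<Sum>n. (norm (ell2_nth x n))\<^sup>2)"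
    by (simp add: inner_ell2_def cinner_ell2_def cinner_self suminf_of_real [symmetric]
      summable_ell2 del: of_real_power)
  show "0 \<le> inner x x" by (simp add: eq suminf_nonneg summable_ell2)
  show "inner x x = 0 \<longleftrightarrow> x = 0"
    by (auto simp: eq suminf_eq_zero_iff summable_ell2 zero_ell2.rep_eq intro!: ell2_eqI)
  show "norm x = sqrt (inner x x)" by (rule norm_ell2_def)
qed

end

lemma norm_ell2_sq: "(norm x)\<^sup>2 = (\<Sum>n. (norm (ell2_nth x n))\<^sup>2)" for x :: "'a::complex_inner ell2"
proof -
  have "(norm x)\<^sup>2 = Re (\<Sum>n. cinner (ell2_nth x n) (ell2_nth x n))"
    by (simp only: power2_norm_eq_inner inner_ell2_def cinner_ell2_def)
  also have "\<dots> = (\<Sum>n. (norm (ell2_nth x n))\<^sup>2)"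
    by (simp add: cinner_self suminf_of_real [symmetric] summable_ell2 del: of_real_power)
  finally show ?thesis .
qed

lemma sum_norm_ell2_le: "(\<Sum>n<N. (norm (ell2_nth x n))\<^sup>2) \<le> (norm x)\<^sup>2"
  for x :: "'a::complex_inner ell2"
  unfolding norm_ell2_sq by (rule sum_le_suminf [OF summable_ell2]) auto

lemma norm_ell2_nth_le: "norm (ell2_nth x n) \<le> norm x" for x :: "'a::complex_inner ell2"
proof -
  have "(norm (ell2_nth x n))\<^sup>2 \<le> (\<Sum>n<Suc n. (norm (ell2_nth x n))\<^sup>2)"
    by (rule member_le_sum) auto
  also have "\<dots> \<le> (norm x)\<^sup>2" by (rule sum_norm_ell2_le)
  finally show ?thesis by (simp add: power2_le_iff_abs_le)
qed

lemma ell2_bound: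
  fixes f :: "nat \<Rightarrow> 'a::complex_inner"
  assumes b: "\<And>N. (\<Sum>n<N. (norm (f n))\<^sup>2) \<le> c\<^sup>2" and c: "0 \<le> c"
  shows "summable (\<lambda>n. (norm (f n))\<^sup>2)" and "ell2_nth (Abs_ell2 f) = f" and "norm (Abs_ell2 f) \<le> c"
proof -
  show s: "summable (\<lambda>n. (norm (f n))\<^sup>2)"
    by (rule bounded_imp_summable [of _ "c\<^sup>2"])
      (use b in \<open>auto simp: lessThan_Suc_atMost [symmetric] simp del: sum.lessThan_Suc\<close>)
  then show nth: "ell2_nth (Abs_ell2 f) = f" by (simp add: Abs_ell2_inverse)
  have "(norm (Abs_ell2 f))\<^sup>2 \<le> c\<^sup>2"
    unfolding norm_ell2_sq nth by (rule suminf_le_const [OF s b])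
  then show "norm (Abs_ell2 f) \<le> c" using c by (rule power2_le_imp_le)
qed

instance ell2 :: (chilbert_space) chilbert_space
proof
  fix X :: "nat \<Rightarrow> 'a ell2"
  assume X: "Cauchy X"
  have "Cauchy (\<lambda>i. ell2_nth (X i) n)" for n
  proof (rule CauchyI)
    fix e :: real assume "e > 0"
    then obtain M where "\<forall>i\<ge>M. \<forall>j\<ge>M. norm (X i - X j) < e" using CauchyD [OF X] by blast
    then show "\<exists>M. \<forall>i\<ge>M. \<forall>j\<ge>M. norm (ell2_nth (X i) n - ell2_nth (X j) n) < e"
      using norm_ell2_nth_le [of "X _ - X _" n] by (metis minus_ell2.rep_eq order_le_less_trans)
  qed
  then have "\<forall>n. \<exists>l. (\<lambda>i. ell2_nth (X i) n) \<longlonglongrightarrow> l"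
    by (simp add: Cauchy_convergent_iff convergent_def)
  then obtain f where f: "\<And>n. (\<lambda>i. ell2_nth (X i) n) \<longlonglongrightarrow> f n" by metis
  have close: "\<exists>M. \<forall>i\<ge>M. \<forall>N. (\<Sum>n<N. (norm (ell2_nth (X i) n - f n))\<^sup>2) \<le> e\<^sup>2"
    if e: "e > 0" for e
  proof -
    obtain M where M: "\<forall>i\<ge>M. \<forall>j\<ge>M. norm (X i - X j) < e" using CauchyD [OF X e] by blast
    have "(\<Sum>n<N. (norm (ell2_nth (X i) n - f n))\<^sup>2) \<le> e\<^sup>2" if "i \<ge> M" for i N
    proof (rule LIMSEQ_le_const2)
      show "(\<lambda>j. \<Sum>n<N. (norm (ell2_nth (X i) n - ell2_nth (X j) n))\<^sup>2)
          \<longlonglongrightarrow> (\<Sum>n<N. (norm (ell2_nth (X i) n - f n))\<^sup>2)"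
        by (intro tendsto_intros f)
      have "(\<Sum>n<N. (norm (ell2_nth (X i) n - ell2_nth (X j) n))\<^sup>2) \<le> e\<^sup>2" if "j \<ge> M" for j
      proof -
        have "(norm (X i - X j))\<^sup>2 \<le> e\<^sup>2"
          using M \<open>i \<ge> M\<close> that by (intro power_mono) (auto intro: less_imp_le)
        with sum_norm_ell2_le [of "X i - X j" N] show ?thesis by (simp add: minus_ell2.rep_eq)
      qed
      then show "\<exists>M. \<forall>j\<ge>M. (\<Sum>n<N. (norm (ell2_nth (X i) n - ell2_nth (X j) n))\<^sup>2) \<le> e\<^sup>2"
        by blast
    qed
    then show ?thesis by blast
  qed
  obtain M where M: "\<And>N. (\<Sum>n<N. (norm (ell2_nth (X M) n - f n))\<^sup>2) \<le> 1\<^sup>2"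
    using close [of 1] by auto
  have "summable (\<lambda>n. (norm (f n - ell2_nth (X M) n))\<^sup>2)"
    using ell2_bound(1) [OF M] by (simp add: norm_minus_commute)
  from summable_norm2_add [OF this summable_ell2 [of "X M"]]
  have nth: "ell2_nth (Abs_ell2 f) = f" by (simp add: Abs_ell2_inverse)
  have "X \<longlonglongrightarrow> Abs_ell2 f"
  proof (rule LIMSEQ_I)
    fix r :: real assume r: "r > 0"
    then obtain M where M: "\<And>i N. i \<ge> M \<Longrightarrow> (\<Sum>n<N. (norm (ell2_nth (X i) n - f n))\<^sup>2) \<le> (r / 2)\<^sup>2"
      using close [of "r / 2"] by auto
    have "norm (X i - Abs_ell2 f) < r" if "i \<ge> M" for i
    proof -
      have "X i - Abs_ell2 f = Abs_ell2 (\<lambda>n. ell2_nth (X i) n - f n)"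
        using r by (intro ell2_eqI)
          (simp add: ell2_bound(2) [OF M [OF that]] minus_ell2.rep_eq nth)
      then show ?thesis using ell2_bound(3) [OF M [OF that]] r by simp
    qed
    then show "\<exists>no. \<forall>n\<ge>no. norm (X n - Abs_ell2 f) < r" by blast
  qed
  then show "convergent X" by (rule convergentI)
qed

lift_definition ell2_tensor :: "'a::chilbert_space \<Rightarrow> complex ell2 \<Rightarrow> 'a ell2"
  is "\<lambda>h \<xi> n. \<xi> n *\<^sub>C h"
  by (simp add: power_mult_distrib summable_mult2)

lemma ell2_tensor_add_left: "ell2_tensor (h + h') \<xi> = ell2_tensor h \<xi> + ell2_tensor h' \<xi>"
  by transfer (simp add: scaleC_add_right)

lemma ell2_tensor_add_right: "ell2_tensor h (\<xi> + \<xi>') = ell2_tensor h \<xi> + ell2_tensor h \<xi>'"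
  by transfer (simp add: scaleC_add_left)

lemma ell2_tensor_scaleC_left: "ell2_tensor (c *\<^sub>C h) \<xi> = c *\<^sub>C ell2_tensor h \<xi>"
  by transfer (simp add: mult.commute)

lemma ell2_tensor_scaleC_right: "ell2_tensor h (c *\<^sub>C \<xi>) = c *\<^sub>C ell2_tensor h \<xi>"
  by transfer simp

lemma ell2_tensor_cinner:
  "cinner (ell2_tensor h \<xi>) (ell2_tensor h' \<xi>') = cinner h h' * cinner \<xi> \<xi>'"
proof -
  have "cinner (ell2_tensor h \<xi>) (ell2_tensor h' \<xi>')
      = (\<Sum>n. cinner h h' * cinner (ell2_nth \<xi> n) (ell2_nth \<xi>' n))"
    by (simp add: cinner_ell2_def ell2_tensor.rep_eq cinner_complex_def mult_ac)
  also have "\<dots> = cinner h h' * cinner \<xi> \<xi>'"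
    unfolding cinner_ell2_def by (rule suminf_mult [OF summable_cinner_ell2])
  finally show ?thesis .
qed

definition ell2_unit :: "nat \<Rightarrow> complex ell2"
  where "ell2_unit m = Abs_ell2 (\<lambda>n. of_bool (n = m))"

lemma ell2_unit_nth [simp]: "ell2_nth (ell2_unit m) n = of_bool (n = m)"
proof -
  have "summable (\<lambda>n. (cmod (of_bool (n = m)))\<^sup>2)"
    by (rule summable_finite [of "{m}"]) auto
  then show ?thesis by (simp add: ell2_unit_def Abs_ell2_inverse)
qed

lemma ell2_nth_sum: "ell2_nth (\<Sum>i\<in>I. f i) n = (\<Sum>i\<in>I. ell2_nth (f i) n)"
  by (induction I rule: infinite_finite_induct) (simp_all add: zero_ell2.rep_eq plus_ell2.rep_eq)

lemma ell2_tensor_expansion: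
  "(\<lambda>N. \<Sum>n<N. ell2_tensor (ell2_nth x n) (ell2_unit n)) \<longlonglongrightarrow> x"
proof -
  define t where "t N = (\<Sum>n<N. ell2_tensor (ell2_nth x n) (ell2_unit n))" for N
  have t: "ell2_nth (t N) n = (if n < N then ell2_nth x n else 0)" for n N
    by (simp add: t_def ell2_nth_sum ell2_tensor.rep_eq of_bool_def if_distrib [of "\<lambda>c. c *\<^sub>C _"]
      sum.delta cong: if_cong)
  have "(norm (x - t N))\<^sup>2 = (\<Sum>n. (norm (ell2_nth x (n + N)))\<^sup>2)" for N
  proof -
    have "(norm (x - t N))\<^sup>2 = (\<Sum>n. (norm (ell2_nth (x - t N) (n + N)))\<^sup>2)
        + (\<Sum>n<N. (norm (ell2_nth (x - t N) n))\<^sup>2)"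
      unfolding norm_ell2_sq by (rule suminf_split_initial_segment [OF summable_ell2])
    then show ?thesis by (simp add: minus_ell2.rep_eq t)
  qed
  then have "(\<lambda>N. (norm (x - t N))\<^sup>2) \<longlonglongrightarrow> 0"
    using suminf_exist_split2 [OF summable_ell2 [of x]] by simp
  then have "(\<lambda>N. sqrt ((norm (x - t N))\<^sup>2)) \<longlonglongrightarrow> sqrt 0" by (rule tendsto_real_sqrt)
  then have "(\<lambda>N. norm (t N - x)) \<longlonglongrightarrow> 0" by (simp add: norm_minus_commute)
  then show ?thesis unfolding t_def [symmetric] by (rule LIM_zero_cancel [OF tendsto_norm_zero_cancel])
qed

lemma ell2_tensor_dense:
  "closure (complex_vector.span (range (\<lambda>(h, \<xi>). ell2_tensor h \<xi>))) = UNIV"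
proof -
  have "x \<in> closure (complex_vector.span (range (\<lambda>(h, \<xi>). ell2_tensor h \<xi>)))" for x :: "'a ell2"
    unfolding closure_sequential
  proof (intro exI conjI allI)
    show "(\<lambda>N. \<Sum>n<N. ell2_tensor (ell2_nth x n) (ell2_unit n)) \<longlonglongrightarrow> x"
      by (rule ell2_tensor_expansion)
    show "(\<Sum>n<N. ell2_tensor (ell2_nth x n) (ell2_unit n))
        \<in> complex_vector.span (range (\<lambda>(h, \<xi>). ell2_tensor h \<xi>))" for N
      by (intro complex_vector.span_sum complex_vector.span_base) auto
  qed
  then show ?thesis by blast
qed


section \<open>Tensor products of operators\<close>

lemma ell2_operator_ex:
  fixes F :: "'a::chilbert_space ell2 \<Rightarrow> nat \<Rightarrow> 'b::chilbert_space"
  assumes add: "\<And>x y n. F (x + y) n = F x n + F y n"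
    and scale: "\<And>c x n. F (c *\<^sub>C x) n = c *\<^sub>C F x n"
    and b: "\<And>x N. (\<Sum>n<N. (norm (F x n))\<^sup>2) \<le> (C * norm x)\<^sup>2" and C: "0 \<le> C"
  shows "\<exists>R\<in>cblinfun. \<forall>x n. ell2_nth (R x) n = F x n"
proof -
  have C': "0 \<le> C * norm x" for x :: "'a ell2" using C by simp
  define R where "R x = Abs_ell2 (F x)" for x
  have nth: "ell2_nth (R x) n = F x n" for x n
    unfolding R_def by (simp add: ell2_bound(2) [OF b C'])
  have scC: "R (c *\<^sub>C x) = c *\<^sub>C R x" for c x
    by (rule ell2_eqI) (simp add: nth scaleC_ell2.rep_eq scale)
  have bl: "bounded_linear R"
  proof (rule bounded_linear_intro)
    show "R (x + y) = R x + R y" for x y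
      by (rule ell2_eqI) (simp add: nth plus_ell2.rep_eq add)
    show "R (r *\<^sub>R x) = r *\<^sub>R R x" for r x by (simp add: scaleR_scaleC scC)
    show "norm (R x) \<le> norm x * C" for x
      using ell2_bound(3) [OF b C'] by (simp add: R_def mult.commute)
  qed
  show ?thesis
    by (rule bexI [of _ "Blinfun R"])
      (simp_all add: cblinfun_def bounded_linear_Blinfun_apply [OF bl] nth scC)
qed

lemma norm_ell2_tensor: "norm (ell2_tensor h \<xi>) = norm h * norm \<xi>"
proof -
  have "complex_of_real ((norm (ell2_tensor h \<xi>))\<^sup>2) = complex_of_real ((norm h * norm \<xi>)\<^sup>2)"
    by (simp only: cinner_self [symmetric] ell2_tensor_cinner)
      (simp add: cinner_self power_mult_distrib)
  then have "(norm (ell2_tensor h \<xi>))\<^sup>2 = (norm h * norm \<xi>)\<^sup>2"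
    by (simp only: of_real_eq_iff)
  then show ?thesis by (simp add: power2_eq_iff_nonneg)
qed

lemma ell2_slice_ex:
  "\<exists>A :: 'a::chilbert_space ell2 \<Rightarrow>\<^sub>L 'a. A \<in> cblinfun \<and>
    (\<forall>h \<eta>. A (ell2_tensor h \<eta>) = cinner \<xi> \<eta> *\<^sub>C h)"
proof -
  have bl: "bounded_linear (\<lambda>h :: 'a. ell2_tensor h \<xi>)"
    by (rule bounded_linear_intro [of _ "norm \<xi>"])
      (simp_all add: ell2_tensor_add_left scaleR_scaleC ell2_tensor_scaleC_left norm_ell2_tensor)
  define L where "L = Blinfun (\<lambda>h :: 'a. ell2_tensor h \<xi>)"
  have L: "L h = ell2_tensor h \<xi>" for h
    by (simp add: L_def bounded_linear_Blinfun_apply [OF bl])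
  have Lc: "L \<in> cblinfun" by (simp add: cblinfun_def L ell2_tensor_scaleC_left)
  have "adj L (ell2_tensor h \<eta>) = cinner \<xi> \<eta> *\<^sub>C h" for h \<eta>
    by (rule cinner_ext) (simp add: adj(2) [OF Lc, symmetric] L ell2_tensor_cinner mult.commute)
  then show ?thesis using adj(1) [OF Lc] by blast
qed

lemma orthonormal_ex:
  fixes F :: "'a::complex_inner set"
  assumes "finite F"
  shows "\<exists>E. finite E \<and> (\<forall>e\<in>E. \<forall>e'\<in>E. cinner e e' = of_bool (e = e')) \<and> F \<subseteq> complex_vector.span E"
  using assms
proof induction
  case empty
  then show ?case by (intro exI [of _ "{}"]) simp
next
  case (insert v F)
  then obtain E where E: "finite E" "\<And>e e'. e \<in> E \<Longrightarrow> e' \<in> E \<Longrightarrow> cinner e e' = of_bool (e = e')"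
    "F \<subseteq> complex_vector.span E" by blast
  define p where "p = (\<Sum>e\<in>E. cinner e v *\<^sub>C e)"
  define w where "w = v - p"
  have p: "p \<in> complex_vector.span E"
    unfolding p_def by (intro complex_vector.span_sum complex_vector.span_scale complex_vector.span_base)
  have orth: "cinner e w = 0" if "e \<in> E" for e
  proof -
    have "cinner e p = (\<Sum>e'\<in>E. if e' = e then cinner e v else 0)"
      unfolding p_def cinner_sum_right by (intro sum.cong) (auto simp: E(2) that)
    then show ?thesis using that E(1) by (simp add: w_def cinner_diff_right)
  qed
  have orth': "cinner w e = 0" if "e \<in> E" for e
    by (subst cinner_commute) (simp add: orth [OF that])
  show ?case
  proof (cases "w = 0")
    case True
    then have "v \<in> complex_vector.span E" using p by (simp add: w_def)
    with E show ?thesis by (intro exI [of _ E]) auto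
  next
    case False
    define u where "u = complex_of_real (inverse (norm w)) *\<^sub>C w"
    have uu: "cinner u u = 1"
      using False by (simp add: cinner_self u_def norm_inverse)
    have "u \<notin> E" using orth [of u] False by (auto simp: u_def cinner_self)
    have ue: "cinner u e = 0" "cinner e u = 0" if "e \<in> E" for e
      using that by (simp_all add: u_def orth orth')
    have "w = complex_of_real (norm w) *\<^sub>C u" using False by (simp add: u_def)
    then have "w \<in> complex_vector.span (insert u E)"
      by (metis complex_vector.span_base complex_vector.span_scale insertI1)
    moreover have sub: "complex_vector.span E \<subseteq> complex_vector.span (insert u E)"
      by (intro complex_vector.span_mono) auto
    ultimately have "v \<in> complex_vector.span (insert u E)"
      using p complex_vector.span_add [of w "insert u E" p] by (auto simp: w_def)
    with sub E uu ue \<open>u \<notin> E\<close> show ?thesis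
      by (intro exI [of _ "insert u E"]) auto
  qed
qed

lemma cinner_adj_ell2_unit:
  assumes k: "k \<in> cblinfun"
  shows "cinner (adj k (ell2_unit m)) \<eta> = ell2_nth (k \<eta>) m"
proof -
  have "cinner (adj k (ell2_unit m)) \<eta> = cinner (ell2_unit m) (k \<eta>)"
    by (metis adj(2) [OF k] cinner_commute)
  also have "\<dots> = (\<Sum>n. if n = m then ell2_nth (k \<eta>) n else 0)"
    unfolding cinner_ell2_def by (rule suminf_cong) (simp add: cinner_complex_def)
  also have "\<dots> = ell2_nth (k \<eta>) m"
    by (subst suminf_finite [of "{m}"]) auto
  finally show ?thesis .
qed

lemma ell2_amplification_bound:
  fixes k :: "complex ell2 \<Rightarrow>\<^sub>L complex ell2" and x :: "'a::chilbert_space ell2"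
  assumes k: "k \<in> cblinfun"
    and A: "\<And>m. A m \<in> cblinfun"
      "\<And>m h \<eta>. A m (ell2_tensor h \<eta>) = cinner (adj k (ell2_unit m)) \<eta> *\<^sub>C h"
  shows "(\<Sum>m<M. (norm (blinfun_apply (A m) x))\<^sup>2) \<le> (norm k * norm x)\<^sup>2"
proof -
  define t where "t N = (\<Sum>n<N. ell2_tensor (ell2_nth x n) (ell2_unit n))" for N
  have fin: "(\<Sum>m<M. (norm (A m (t N)))\<^sup>2) \<le> (norm k * norm (t N))\<^sup>2" for N
  proof -
    obtain E where E: "finite E" "\<And>e e'. e \<in> E \<Longrightarrow> e' \<in> E \<Longrightarrow> cinner e e' = of_bool (e = e')"
      "ell2_nth x ` {..<N} \<subseteq> complex_vector.span E"
      using orthonormal_ex [of "ell2_nth x ` {..<N}"] by auto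
    have nE: "norm e = 1" if "e \<in> E" for e
      using E(2) [OF that that] cinner_self [of e] norm_ge_zero [of e]
      by (simp add: power2_eq_1_iff flip: of_real_power)
    have "\<exists>a. ell2_nth x n = (\<Sum>e\<in>E. a e *\<^sub>C e)" if "n < N" for n
      using that E(3) unfolding complex_vector.span_finite [OF E(1)] by auto
    then obtain a where a: "\<And>n. n < N \<Longrightarrow> ell2_nth x n = (\<Sum>e\<in>E. a n e *\<^sub>C e)" by metis
    define c where "c e = (\<Sum>n<N. a n e *\<^sub>C ell2_unit n)" for e
    have tensor_sum_left: "ell2_tensor (\<Sum>i\<in>I. f i) \<eta> = (\<Sum>i\<in>I. ell2_tensor (f i) \<eta>)"
      for f :: "'a \<Rightarrow> 'a" and I \<eta>
      by (rule Modules.additive.sum) (unfold_locales, rule ell2_tensor_add_left)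
    have tensor_sum_right: "ell2_tensor h (\<Sum>i\<in>I. f i) = (\<Sum>i\<in>I. ell2_tensor h (f i))"
      for f :: "nat \<Rightarrow> complex ell2" and I and h :: 'a
      by (rule Modules.additive.sum) (unfold_locales, rule ell2_tensor_add_right)
    have "t N = (\<Sum>n<N. \<Sum>e\<in>E. a n e *\<^sub>C ell2_tensor e (ell2_unit n))"
      by (simp add: t_def a tensor_sum_left ell2_tensor_scaleC_left)
    also have "\<dots> = (\<Sum>e\<in>E. ell2_tensor e (c e))"
      by (subst sum.swap) (simp add: c_def tensor_sum_right ell2_tensor_scaleC_right)
    finally have tN: "t N = (\<Sum>e\<in>E. ell2_tensor e (c e))" .
    have ntN: "(norm (t N))\<^sup>2 = (\<Sum>e\<in>E. (norm (c e))\<^sup>2)"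
    proof -
      have "(norm (t N))\<^sup>2 = (\<Sum>e\<in>E. (norm (ell2_tensor e (c e)))\<^sup>2)"
        unfolding tN
        by (rule norm_sum_Pythagorean [OF E(1)])
          (auto simp: pairwise_def orthogonal_def inner_eq_Re_cinner ell2_tensor_cinner E(2))
      then show ?thesis by (simp add: norm_ell2_tensor nE)
    qed
    have nA: "(norm (A m (t N)))\<^sup>2 = (\<Sum>e\<in>E. (norm (ell2_nth (k (c e)) m))\<^sup>2)" for m
    proof -
      have "A m (t N) = (\<Sum>e\<in>E. ell2_nth (k (c e)) m *\<^sub>C e)"
        by (simp add: tN blinfun.sum_right A(2) cinner_adj_ell2_unit [OF k])
      also have "(norm \<dots>)\<^sup>2 = (\<Sum>e\<in>E. (norm (ell2_nth (k (c e)) m *\<^sub>C e))\<^sup>2)"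
        by (rule norm_sum_Pythagorean [OF E(1)])
          (auto simp: pairwise_def orthogonal_def inner_eq_Re_cinner E(2))
      finally show ?thesis by (simp add: nE)
    qed
    have "(\<Sum>m<M. (norm (A m (t N)))\<^sup>2) = (\<Sum>e\<in>E. \<Sum>m<M. (norm (ell2_nth (k (c e)) m))\<^sup>2)"
      unfolding nA by (rule sum.swap)
    also have "\<dots> \<le> (\<Sum>e\<in>E. (norm k * norm (c e))\<^sup>2)"
      by (intro sum_mono order_trans [OF sum_norm_ell2_le] power_mono norm_blinfun) simp
    also have "\<dots> = (norm k * norm (t N))\<^sup>2"
      by (simp add: power_mult_distrib ntN sum_distrib_left)
    finally show ?thesis .
  qed
  have t: "t \<longlonglongrightarrow> x" unfolding t_def by (rule ell2_tensor_expansion)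
  show ?thesis
  proof (rule LIMSEQ_le)
    show "(\<lambda>N. \<Sum>m<M. (norm (A m (t N)))\<^sup>2) \<longlonglongrightarrow> (\<Sum>m<M. (norm (A m x))\<^sup>2)"
      by (intro tendsto_intros t)
    show "(\<lambda>N. (norm k * norm (t N))\<^sup>2) \<longlonglongrightarrow> (norm k * norm x)\<^sup>2"
      by (intro tendsto_intros t)
  qed (use fin in blast)
qed

text \<open>\<open>s \<otimes> k\<close> is the unique bounded complex-linear operator with
  \<open>(s \<otimes> k)(h \<otimes> \<xi>) = s h \<otimes> k \<xi>\<close>; see \<open>op_tensor_ex1\<close> below.\<close>

definition op_tensor :: "('a::chilbert_space \<Rightarrow>\<^sub>L 'b::chilbert_space) \<Rightarrow>
    (complex ell2 \<Rightarrow>\<^sub>L complex ell2) \<Rightarrow> 'a ell2 \<Rightarrow>\<^sub>L 'b ell2"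
  where "op_tensor s k = (THE R. R \<in> cblinfun \<and>
    (\<forall>h \<xi>. R (ell2_tensor h \<xi>) = ell2_tensor (s h) (k \<xi>)))"

lemma op_tensor_ex1:
  fixes s :: "'a::chilbert_space \<Rightarrow>\<^sub>L 'b::chilbert_space"
  assumes s: "s \<in> cblinfun" and k: "k \<in> cblinfun"
  shows "\<exists>!R. R \<in> cblinfun \<and> (\<forall>h \<xi>. R (ell2_tensor h \<xi>) = ell2_tensor (s h) (k \<xi>))"
proof -
  have s': "s (c *\<^sub>C x) = c *\<^sub>C s x" for c x using s by (auto simp: cblinfun_def)
  have "\<exists>R\<in>cblinfun. \<forall>x n. ell2_nth (R x) n = s (ell2_nth x n)"
  proof (rule ell2_operator_ex [where C = "norm s"])
    fix x :: "'a ell2" and N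
    have "(\<Sum>n<N. (norm (s (ell2_nth x n)))\<^sup>2) \<le> (\<Sum>n<N. (norm s * norm (ell2_nth x n))\<^sup>2)"
      by (intro sum_mono power_mono norm_blinfun) simp
    also have "\<dots> \<le> (norm s * norm x)\<^sup>2"
      using sum_norm_ell2_le [of x N]
      by (simp add: power_mult_distrib mult_left_mono flip: sum_distrib_left)
    finally show "(\<Sum>n<N. (norm (s (ell2_nth x n)))\<^sup>2) \<le> (norm s * norm x)\<^sup>2" .
  qed (simp_all add: plus_ell2.rep_eq scaleC_ell2.rep_eq blinfun.add_right s')
  then obtain P where P: "P \<in> cblinfun" "\<And>x n. ell2_nth (blinfun_apply P x) n = s (ell2_nth x n)"
    by metis
  have "\<forall>m. \<exists>A :: 'a ell2 \<Rightarrow>\<^sub>L 'a. A \<in> cblinfun \<and>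
      (\<forall>h \<eta>. A (ell2_tensor h \<eta>) = cinner (adj k (ell2_unit m)) \<eta> *\<^sub>C h)"
    using ell2_slice_ex by blast
  then obtain A :: "nat \<Rightarrow> 'a ell2 \<Rightarrow>\<^sub>L 'a" where A: "\<And>m. A m \<in> cblinfun"
      "\<And>m h \<eta>. A m (ell2_tensor h \<eta>) = cinner (adj k (ell2_unit m)) \<eta> *\<^sub>C h"
    by metis
  have A': "A m (c *\<^sub>C x) = c *\<^sub>C A m x" for m c x using A(1) [of m] by (auto simp: cblinfun_def)
  have "\<exists>R\<in>cblinfun. \<forall>x n. ell2_nth (R x) n = A n x"
    by (rule ell2_operator_ex [where C = "norm k"])
      (simp_all add: blinfun.add_right A' ell2_amplification_bound [OF k A])
  then obtain Q where Q: "Q \<in> cblinfun" "\<And>x n. ell2_nth (blinfun_apply Q x) n = A n x"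
    by metis
  show ?thesis
  proof (rule ex1I)
    show "P o\<^sub>L Q \<in> cblinfun \<and> (\<forall>h \<xi>. (P o\<^sub>L Q) (ell2_tensor h \<xi>) = ell2_tensor (s h) (k \<xi>))"
    proof (intro conjI allI)
      show "P o\<^sub>L Q \<in> cblinfun" using P(1) Q(1) by (simp add: cblinfun_def)
      show "(P o\<^sub>L Q) (ell2_tensor h \<xi>) = ell2_tensor (s h) (k \<xi>)" for h \<xi>
        by (rule ell2_eqI) (simp add: P(2) Q(2) A(2) s' cinner_adj_ell2_unit [OF k] ell2_tensor.rep_eq)
    qed
    fix R assume R: "R \<in> cblinfun \<and> (\<forall>h \<xi>. R (ell2_tensor h \<xi>) = ell2_tensor (s h) (k \<xi>))"
    show "R = P o\<^sub>L Q"
    proof (rule blinfun_eqI)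
      fix x :: "'a ell2"
      define t where "t N = (\<Sum>n<N. ell2_tensor (ell2_nth x n) (ell2_unit n))" for N
      have t: "t \<longlonglongrightarrow> x" unfolding t_def by (rule ell2_tensor_expansion)
      have "(P o\<^sub>L Q) (ell2_tensor h \<xi>) = ell2_tensor (s h) (k \<xi>)" for h \<xi>
        by (rule ell2_eqI) (simp add: P(2) Q(2) A(2) s' cinner_adj_ell2_unit [OF k] ell2_tensor.rep_eq)
      then have "R (t N) = (P o\<^sub>L Q) (t N)" for N
        using R by (simp only: t_def blinfun.sum_right)
      moreover have "(\<lambda>N. R (t N)) \<longlonglongrightarrow> R x" by (intro tendsto_intros t)
      moreover have "(\<lambda>N. (P o\<^sub>L Q) (t N)) \<longlonglongrightarrow> (P o\<^sub>L Q) x" by (intro tendsto_intros t)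
      ultimately show "R x = (P o\<^sub>L Q) x" by (simp only: LIMSEQ_unique)
    qed
  qed
qed

lemma op_tensor:
  assumes "s \<in> cblinfun" "k \<in> cblinfun"
  shows "op_tensor s k \<in> cblinfun"
    and "op_tensor s k (ell2_tensor h \<xi>) = ell2_tensor (s h) (k \<xi>)"
  using theI' [OF op_tensor_ex1 [OF assms]] unfolding op_tensor_def [symmetric] by auto

text \<open>\<open>S \<otimes> K\<close>, with \<open>K\<close> the compact operators on \<open>\<ell>\<^sup>2\<close>.\<close>

definition stabilization :: "('a::chilbert_space \<Rightarrow>\<^sub>L 'a) set \<Rightarrow> ('a ell2 \<Rightarrow>\<^sub>L 'a ell2) set"
  where "stabilization S = closed_cspan {op_tensor s k | s k. s \<in> S \<and> compact_op k}"

end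

theory Submission
  imports Defs
begin

text \<open>Replace the TRO by its norm closure \<open>M\<close>. Since the span of \<open>M\<^sup>*M\<close> approximates the identity of \<open>H\<close>,
  some finite sum \<open>\<Sum> b\<^sub>i\<^sup>* b\<^sub>i\<close> is invertible, and multiplying by its inverse square root yields
  \<open>c\<^sub>i \<in> M\<close> with \<open>\<Sum> c\<^sub>i\<^sup>* c\<^sub>i = 1\<close>. With isometries \<open>v\<^sub>i\<close> of \<open>\<ell>\<^sup>2\<close> with orthogonal ranges,
  \<open>V = \<Sum> c\<^sub>i \<otimes> v\<^sub>i\<close> is an isometry from \<open>H \<otimes> \<ell>\<^sup>2\<close> to \<open>K \<otimes> \<ell>\<^sup>2\<close>; symmetrically there is an isometry
  \<open>W\<close> in the other direction. If \<open>J, L\<close> are isometries with \<open>J J\<^sup>* + L L\<^sup>* = 1\<close>, then \<open>X = V J\<close> and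
  \<open>Y = 1 - V V\<^sup>* + V L V\<^sup>*\<close> are isometries with \<open>X X\<^sup>* + Y Y\<^sup>* = 1\<close>, that is,
  \<open>(H \<otimes> \<ell>\<^sup>2) \<oplus> (K \<otimes> \<ell>\<^sup>2) \<cong> K \<otimes> \<ell>\<^sup>2\<close>. With \<open>X', Y'\<close> obtained from \<open>W\<close> in the same way,
  \<open>U = X Y'\<^sup>* + Y X'\<^sup>*\<close> is unitary. It is a finite sum of operators \<open>a \<otimes> v\<close> with \<open>a \<in> M\<close>, and conjugation
  by such a sum maps \<open>S \<otimes> \<K>\<close> into \<open>T \<otimes> \<K>\<close> because \<open>M S M\<^sup>* \<subseteq> T\<close>; likewise for \<open>U\<^sup>*\<close>.\<close>

section \<open>Bounded operators and adjoints\<close>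

lemma blinfun_compose_assoc: "(a o\<^sub>L b) o\<^sub>L c = a o\<^sub>L (b o\<^sub>L c)"
  by (rule blinfun_eqI) simp

lemma id_blinfun_compose [simp]: "id_blinfun o\<^sub>L a = a" "a o\<^sub>L id_blinfun = a"
  by (rule blinfun_eqI, simp)+

lemmas blinfun_compose_distribs =
  bounded_bilinear.add_left [OF bounded_bilinear_blinfun_compose]
  bounded_bilinear.add_right [OF bounded_bilinear_blinfun_compose]
  bounded_bilinear.diff_left [OF bounded_bilinear_blinfun_compose]
  bounded_bilinear.diff_right [OF bounded_bilinear_blinfun_compose]

lemmas blinfun_compose_sum =
  bounded_bilinear.sum_left [OF bounded_bilinear_blinfun_compose]
  bounded_bilinear.sum_right [OF bounded_bilinear_blinfun_compose]

lemma blinfun_compose_scaleC: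
  "(c *\<^sub>C a) o\<^sub>L b = c *\<^sub>C (a o\<^sub>L b)"
  "a \<in> cblinfun \<Longrightarrow> a o\<^sub>L (c *\<^sub>C b) = c *\<^sub>C (a o\<^sub>L b)"
  by (rule blinfun_eqI, simp add: scaleC_blinfun.rep_eq cblinfun_def)+

lemma cblinfun_compose [intro]: "a \<in> cblinfun \<Longrightarrow> b \<in> cblinfun \<Longrightarrow> a o\<^sub>L b \<in> cblinfun"
  by (simp add: cblinfun_def)

lemma cblinfun_id [simp, intro]: "id_blinfun \<in> cblinfun"
  by (simp add: cblinfun_def)

lemma subspace_cblinfun: "complex_vector.subspace cblinfun"
  by (auto simp: complex_vector.subspace_def cblinfun_def blinfun.add_left
      scaleC_blinfun.rep_eq scaleC_add_right mult.commute)

lemmas cblinfun_add [intro] = complex_vector.subspace_add [OF subspace_cblinfun]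
lemmas cblinfun_diff [intro] = complex_vector.subspace_diff [OF subspace_cblinfun]
lemmas cblinfun_sum [intro] = complex_vector.subspace_sum [OF subspace_cblinfun]

lemma subspace_scaleR:
  "complex_vector.subspace A \<Longrightarrow> x \<in> A \<Longrightarrow> r *\<^sub>R x \<in> A"
  by (simp add: scaleR_scaleC complex_vector.subspace_scale)

section \<open>Closed complex-linear spans of operators\<close>

lemma bounded_linear_scaleC_blinfun:
  "bounded_linear (\<lambda>a :: 'a::real_normed_vector \<Rightarrow>\<^sub>L 'b::complex_inner. c *\<^sub>C a)"
proof (rule bounded_linear_intro)
  fix a b :: "'a \<Rightarrow>\<^sub>L 'b" and r :: real
  show "c *\<^sub>C (a + b) = c *\<^sub>C a + c *\<^sub>C b" by (rule scaleC_add_right)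
  show "c *\<^sub>C r *\<^sub>R a = r *\<^sub>R c *\<^sub>C a" by (simp add: scaleR_scaleC mult.commute)
  show "norm (c *\<^sub>C a) \<le> norm a * cmod c"
    by (rule norm_blinfun_bound)
      (auto simp: scaleC_blinfun.rep_eq mult.commute [of _ "cmod c"] mult.assoc
        intro!: mult_left_mono norm_blinfun)
qed

lemma closed_cblinfun: "closed cblinfun"
proof -
  have "closed {T :: 'a \<Rightarrow>\<^sub>L 'b. T (c *\<^sub>C x) = c *\<^sub>C T x}" for c and x :: 'a
    by (intro closed_Collect_eq linear_continuous_on
        bounded_linear_compose [OF bounded_linear_scaleC] blinfun.bounded_linear_left)
  moreover have "cblinfun = (\<Inter>c. \<Inter>x. {T :: 'a \<Rightarrow>\<^sub>L 'b. T (c *\<^sub>C x) = c *\<^sub>C T x})"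
    by (auto simp: cblinfun_def)
  ultimately show ?thesis by (metis (no_types, lifting) closed_INT)
qed

lemma subspace_closure:
  fixes A :: "('a::real_normed_vector \<Rightarrow>\<^sub>L 'b::complex_inner) set"
  assumes "complex_vector.subspace A"
  shows "complex_vector.subspace (closure A)"
  unfolding complex_vector.subspace_def
proof (intro conjI ballI allI)
  show "0 \<in> closure A"
    using complex_vector.subspace_0 [OF assms] closure_subset by blast
next
  fix x y assume "x \<in> closure A" "y \<in> closure A"
  then obtain f g where "\<And>n::nat. f n \<in> A" "f \<longlonglongrightarrow> x" "\<And>n::nat. g n \<in> A" "g \<longlonglongrightarrow> y"
    unfolding closure_sequential by metis
  then show "x + y \<in> closure A"
    unfolding closure_sequential
    by (intro exI [of _ "\<lambda>n. f n + g n"])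
      (auto intro: tendsto_add complex_vector.subspace_add [OF assms])
next
  fix c x assume "x \<in> closure A"
  then obtain f where "\<And>n::nat. f n \<in> A" "f \<longlonglongrightarrow> x"
    unfolding closure_sequential by metis
  then show "c *\<^sub>C x \<in> closure A"
    unfolding closure_sequential
    by (intro exI [of _ "\<lambda>n. c *\<^sub>C f n"])
      (auto intro: bounded_linear.tendsto [OF bounded_linear_scaleC_blinfun]
        complex_vector.subspace_scale [OF assms])
qed

lemma subspace_closed_cspan: "complex_vector.subspace (closed_cspan A)"
  unfolding closed_cspan_def by (rule subspace_closure) simp

lemma closed_cspan_base: "x \<in> A \<Longrightarrow> x \<in> closed_cspan A"
  unfolding closed_cspan_def using closure_subset complex_vector.span_base by blast

lemma closed_cspan_mono: "A \<subseteq> B \<Longrightarrow> closed_cspan A \<subseteq> closed_cspan B"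
  unfolding closed_cspan_def by (intro closure_mono complex_vector.span_mono)

text \<open>A bounded map is checked on generators only: linearity extends the inclusion to the
  span, and continuity together with closedness of the target extends it to the closure. Homogeneity
  is required only on \<open>cblinfun\<close>, because composition with a fixed operator commutes
  with complex scalars only under complex linearity.\<close>

lemma closed_cspan_image:
  fixes f :: "('a::chilbert_space \<Rightarrow>\<^sub>L 'b::chilbert_space) \<Rightarrow> 'c::chilbert_space \<Rightarrow>\<^sub>L 'd::chilbert_space"
  assumes f: "bounded_linear f" and fc: "\<And>c x. x \<in> cblinfun \<Longrightarrow> f (c *\<^sub>C x) = c *\<^sub>C f x"
    and A: "A \<subseteq> cblinfun" and B: "\<And>x. x \<in> A \<Longrightarrow> f x \<in> closed_cspan B"
    and x: "x \<in> closed_cspan A"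
  shows "f x \<in> closed_cspan B"
proof -
  interpret bounded_linear f by (rule f)
  have "y \<in> cblinfun \<and> f y \<in> closed_cspan B" if "y \<in> complex_vector.span A" for y
    using that
  proof (induction rule: complex_vector.span_induct_alt)
    case base
    show ?case
      by (simp add: zero complex_vector.subspace_0 [OF subspace_cblinfun]
        complex_vector.subspace_0 [OF subspace_closed_cspan])
  next
    case (step c a y)
    then have "a \<in> cblinfun" using A by auto
    with step show ?case
      by (auto simp: add fc intro!: B complex_vector.subspace_add [OF subspace_closed_cspan]
        complex_vector.subspace_scale [OF subspace_closed_cspan]
        complex_vector.subspace_scale [OF subspace_cblinfun])
  qed
  then have "f ` complex_vector.span A \<subseteq> closed_cspan B" by auto
  moreover have "closed (closed_cspan B)" by (simp add: closed_cspan_def)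
  ultimately have "f ` closure (complex_vector.span A) \<subseteq> closed_cspan B"
    by (intro image_closure_subset linear_continuous_on f)
  then show ?thesis using x by (auto simp: closed_cspan_def)
qed

section \<open>Calculus of adjoints\<close>

lemma adj_eqI:
  fixes T :: "'a::chilbert_space \<Rightarrow>\<^sub>L 'b::chilbert_space" and A :: "'b \<Rightarrow>\<^sub>L 'a"
  assumes "T \<in> cblinfun" and "\<And>x y. cinner (T x) y = cinner x (A y)"
  shows "adj T = A"
  by (rule blinfun_eqI, rule cinner_ext) (metis adj(2) assms)

lemma cinner_adj_left: "T \<in> cblinfun \<Longrightarrow> cinner (adj T x) y = cinner x (T y)"
  by (metis adj(2) cinner_commute)

lemma adj_cblinfun [simp, intro]: "T \<in> cblinfun \<Longrightarrow> adj T \<in> cblinfun"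
  by (rule adj(1))

lemma adj_adj [simp]: "T \<in> cblinfun \<Longrightarrow> adj (adj T) = T"
  by (rule adj_eqI) (simp_all add: cinner_adj_left)

lemma adj_id [simp]: "adj id_blinfun = id_blinfun"
  by (rule adj_eqI) simp_all

lemma adj_zero [simp]: "adj 0 = 0"
  by (rule adj_eqI) (simp_all add: complex_vector.subspace_0 [OF subspace_cblinfun])

lemma adj_compose: "a \<in> cblinfun \<Longrightarrow> b \<in> cblinfun \<Longrightarrow> adj (a o\<^sub>L b) = adj b o\<^sub>L adj a"
  by (rule adj_eqI) (simp_all add: adj(2) [symmetric] cblinfun_compose)

lemma adj_add: "a \<in> cblinfun \<Longrightarrow> b \<in> cblinfun \<Longrightarrow> adj (a + b) = adj a + adj b"
  by (rule adj_eqI) (auto simp: adj(2) [symmetric] blinfun.add_left cinner_add_left cinner_add_right)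

lemma adj_diff: "a \<in> cblinfun \<Longrightarrow> b \<in> cblinfun \<Longrightarrow> adj (a - b) = adj a - adj b"
  by (rule adj_eqI) (auto simp: adj(2) [symmetric] blinfun.diff_left cinner_diff_left cinner_diff_right)

lemma adj_sum: "(\<And>i. i \<in> I \<Longrightarrow> a i \<in> cblinfun) \<Longrightarrow> adj (\<Sum>i\<in>I. a i) = (\<Sum>i\<in>I. adj (a i))"
  by (induction I rule: infinite_finite_induct) (simp_all add: adj_add cblinfun_sum)

lemma adj_scaleC: "a \<in> cblinfun \<Longrightarrow> adj (c *\<^sub>C a) = cnj c *\<^sub>C adj a"
  by (rule adj_eqI)
    (simp_all add: complex_vector.subspace_scale [OF subspace_cblinfun] scaleC_blinfun.rep_eq adj(2))

lemma adj_scaleR: "a \<in> cblinfun \<Longrightarrow> adj (r *\<^sub>R a) = r *\<^sub>R adj a"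
  by (simp add: scaleR_scaleC adj_scaleC)

text \<open>Cauchy-Schwarz bounds the square of \<open>norm (adj T y)\<close> by
  \<open>norm T * norm (adj T y) * norm y\<close>, and one factor cancels. The estimate is what
  makes \<open>adj\<close> continuous.\<close>

lemma norm_adj_le:
  assumes T: "T \<in> cblinfun"
  shows "norm (adj T) \<le> norm T"
proof (rule norm_blinfun_bound)
  fix y
  have "(norm (adj T y))\<^sup>2 = Re (cinner (adj T y) (adj T y))"
    by (simp add: cinner_self del: of_real_power)
  also have "\<dots> = Re (cinner (T (adj T y)) y)" by (simp only: adj(2) [OF T])
  also have "\<dots> \<le> norm (T (adj T y)) * norm y"
    by (rule order_trans [OF complex_Re_le_cmod norm_cinner_le])
  also have "\<dots> \<le> (norm T * norm (adj T y)) * norm y"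
    by (intro mult_right_mono norm_blinfun) simp
  finally have "norm (adj T y) * norm (adj T y) \<le> (norm T * norm y) * norm (adj T y)"
    by (simp add: power2_eq_square mult_ac)
  then show "norm (adj T y) \<le> norm T * norm y"
    by (cases "adj T y = 0") simp_all
qed simp

text \<open>On \<open>cblinfun\<close> the adjoint is additive and does not increase norms, so the
  difference of adjoints is dominated by \<open>f n - l\<close>. Outside that set \<open>adj\<close>
  is not controlled, hence the membership hypotheses on the family and on its limit.\<close>

lemma tendsto_adj:
  assumes f: "\<And>n. f n \<in> cblinfun" and l: "(f \<longlongrightarrow> l) F"
    and lc: "l \<in> cblinfun"
  shows "((\<lambda>n. adj (f n)) \<longlongrightarrow> adj l) F"
proof (rule Lim_null [THEN iffD2])
  have "norm (adj (f n) - adj l) \<le> norm (f n - l)" for n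
    using norm_adj_le [of "f n - l"] f lc by (simp add: adj_diff cblinfun_diff)
  then show "((\<lambda>n. adj (f n) - adj l) \<longlongrightarrow> 0) F"
    by (intro Lim_null_comparison [OF always_eventually tendsto_norm_zero [OF Lim_null [THEN iffD1, OF l]]])
      blast
qed

section \<open>Ternary rings of operators under closure and adjoints\<close>

lemma TRO_closure:
  assumes "TRO M"
  shows "TRO (closure M)"
proof -
  have M: "M \<subseteq> cblinfun" "complex_vector.subspace M"
    and tro: "\<And>a b c. a \<in> M \<Longrightarrow> b \<in> M \<Longrightarrow> c \<in> M \<Longrightarrow> a o\<^sub>L adj b o\<^sub>L c \<in> M"
    using assms by (auto simp: TRO_def)
  have cl: "closure M \<subseteq> cblinfun" by (rule closure_minimal [OF M(1) closed_cblinfun])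
  have "a o\<^sub>L adj b o\<^sub>L c \<in> closure M" if abc: "a \<in> closure M" "b \<in> closure M" "c \<in> closure M" for a b c
  proof -
    obtain f g h where f: "\<And>n::nat. f n \<in> M" "f \<longlonglongrightarrow> a" and g: "\<And>n::nat. g n \<in> M" "g \<longlonglongrightarrow> b"
      and h: "\<And>n::nat. h n \<in> M" "h \<longlonglongrightarrow> c"
      using abc unfolding closure_sequential by metis
    have "(\<lambda>n. adj (g n)) \<longlonglongrightarrow> adj b"
    proof (rule tendsto_adj)
      show "g n \<in> cblinfun" for n using g(1) M(1) by blast
    qed (use g(2) cl abc(2) in blast)+
    then have "(\<lambda>n. f n o\<^sub>L adj (g n) o\<^sub>L h n) \<longlonglongrightarrow> (a o\<^sub>L adj b o\<^sub>L c)"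
      using f h by (intro bounded_bilinear.tendsto [OF bounded_bilinear_blinfun_compose])
    moreover have "f n o\<^sub>L adj (g n) o\<^sub>L h n \<in> M" for n
      by (intro tro f(1) g(1) h(1))
    ultimately show ?thesis
      unfolding closure_sequential by (intro exI [of _ "\<lambda>n. f n o\<^sub>L adj (g n) o\<^sub>L h n"] conjI allI)
  qed
  then show ?thesis using cl subspace_closure [OF M(2)] by (simp add: TRO_def)
qed

text \<open>Taking adjoints reverses a triple product into another triple product. This symmetry
  lets the construction of an isometry be reused in the opposite direction.\<close>

lemma TRO_adj:
  assumes "TRO M"
  shows "TRO (adj ` M)"
proof -
  have M: "M \<subseteq> cblinfun" "complex_vector.subspace M"
    and tro: "\<And>a b c. a \<in> M \<Longrightarrow> b \<in> M \<Longrightarrow> c \<in> M \<Longrightarrow> a o\<^sub>L adj b o\<^sub>L c \<in> M"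
    using assms by (auto simp: TRO_def)
  have "adj a o\<^sub>L adj (adj b) o\<^sub>L adj c = adj (c o\<^sub>L adj b o\<^sub>L a)" if "a \<in> M" "b \<in> M" "c \<in> M" for a b c
  proof -
    have "a \<in> cblinfun" "b \<in> cblinfun" "c \<in> cblinfun" using that M(1) by auto
    then show ?thesis by (simp add: adj_compose cblinfun_compose blinfun_compose_assoc)
  qed
  then have 1: "\<forall>a\<in>adj ` M. \<forall>b\<in>adj ` M. \<forall>c\<in>adj ` M. a o\<^sub>L adj b o\<^sub>L c \<in> adj ` M"
    using tro by auto
  have 2: "complex_vector.subspace (adj ` M)"
    unfolding complex_vector.subspace_def
  proof (intro conjI ballI allI)
    show "0 \<in> adj ` M" by (rule image_eqI [OF _ complex_vector.subspace_0 [OF M(2)]]) simp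
    fix x assume x: "x \<in> adj ` M"
    show "x + y \<in> adj ` M" if y: "y \<in> adj ` M" for y
    proof -
      obtain a b where a: "a \<in> M" "x = adj a" and b: "b \<in> M" "y = adj b" using x y by blast
      moreover have "a \<in> cblinfun" "b \<in> cblinfun" using a b M(1) by auto
      ultimately have "x + y = adj (a + b)" by (simp add: adj_add)
      then show ?thesis using a b complex_vector.subspace_add [OF M(2)] by blast
    qed
    show "c *\<^sub>C x \<in> adj ` M" for c
    proof -
      obtain a where a: "a \<in> M" "x = adj a" using x by blast
      \<comment> \<open>The conjugate scalar compensates for the conjugate linearity of
        \<open>adj\<close>.\<close>
      then have "c *\<^sub>C x = adj (cnj c *\<^sub>C a)" using M(1) by (auto simp: adj_scaleC)
      then show ?thesis using a complex_vector.subspace_scale [OF M(2)] by blast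
    qed
  qed
  have 3: "adj ` M \<subseteq> cblinfun" using M(1) by auto
  show ?thesis unfolding TRO_def by (intro conjI 1 2 3)
qed

section \<open>Tensor products of operators\<close>

lemma blinfun_eq_ell2_tensorI:
  fixes R R' :: "'a::chilbert_space ell2 \<Rightarrow>\<^sub>L 'b::real_normed_vector"
  assumes "\<And>h \<xi>. R (ell2_tensor h \<xi>) = R' (ell2_tensor h \<xi>)"
  shows "R = R'"
proof (rule blinfun_eqI)
  fix x :: "'a ell2"
  define t where "t N = (\<Sum>n<N. ell2_tensor (ell2_nth x n) (ell2_unit n))" for N
  have t: "t \<longlonglongrightarrow> x" unfolding t_def by (rule ell2_tensor_expansion)
  have "R (t N) = R' (t N)" for N by (simp add: t_def blinfun.sum_right assms)
  moreover have "(\<lambda>N. R (t N)) \<longlonglongrightarrow> R x" by (intro tendsto_intros t)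
  moreover have "(\<lambda>N. R' (t N)) \<longlonglongrightarrow> R' x" by (intro tendsto_intros t)
  ultimately show "R x = R' x" by (simp only: LIMSEQ_unique)
qed

text \<open>The difference \<open>y - z\<close> is tested against its own truncations, which are
  finite sums of elementary tensors: these inner products vanish and converge to the squared norm of
  \<open>y - z\<close>.\<close>

lemma ell2_tensor_cinner_ext:
  fixes y z :: "'a::chilbert_space ell2"
  assumes "\<And>h \<xi>. cinner (ell2_tensor h \<xi>) y = cinner (ell2_tensor h \<xi>) z"
  shows "y = z"
proof -
  define t where "t N = (\<Sum>n<N. ell2_tensor (ell2_nth (y - z) n) (ell2_unit n))" for N
  have "(\<lambda>N. inner (t N) (y - z)) \<longlonglongrightarrow> inner (y - z) (y - z)"
    unfolding t_def by (intro tendsto_intros ell2_tensor_expansion)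
  moreover have "inner (t N) (y - z) = 0" for N
    by (simp add: t_def inner_eq_Re_cinner cinner_sum_left cinner_diff_right assms)
  ultimately have "inner (y - z) (y - z) = 0" by (simp add: LIMSEQ_const_iff)
  then show ?thesis by simp
qed

lemma op_tensor_eqI:
  fixes R :: "'a::chilbert_space ell2 \<Rightarrow>\<^sub>L 'b::chilbert_space ell2"
  assumes "s \<in> cblinfun" "k \<in> cblinfun"
    and "\<And>h \<xi>. R (ell2_tensor h \<xi>) = ell2_tensor (s h) (k \<xi>)"
  shows "op_tensor s k = R"
  by (rule blinfun_eq_ell2_tensorI) (simp add: op_tensor(2) assms)

lemma op_tensor_compose:
  assumes "a \<in> cblinfun" "v \<in> cblinfun" "b \<in> cblinfun" "w \<in> cblinfun"
  shows "op_tensor a v o\<^sub>L op_tensor b w = op_tensor (a o\<^sub>L b) (v o\<^sub>L w)"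
  by (rule op_tensor_eqI [symmetric]) (simp_all add: op_tensor(2) assms cblinfun_compose)

lemma op_tensor_id: "op_tensor id_blinfun id_blinfun = id_blinfun"
  by (rule op_tensor_eqI) simp_all

lemma adj_op_tensor:
  assumes a: "a \<in> cblinfun" and v: "v \<in> cblinfun"
  shows "adj (op_tensor a v) = op_tensor (adj a) (adj v)"
  by (rule op_tensor_eqI [symmetric])
    (auto simp: a v op_tensor ell2_tensor_cinner adj(2) [symmetric] intro: ell2_tensor_cinner_ext)

lemma op_tensor_add_left:
  assumes "a \<in> cblinfun" "b \<in> cblinfun" "k \<in> cblinfun"
  shows "op_tensor (a + b) k = op_tensor a k + op_tensor b k"
  by (rule op_tensor_eqI)
    (simp_all add: assms cblinfun_add op_tensor(2) blinfun.add_left ell2_tensor_add_left)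

lemma op_tensor_add_right:
  assumes "a \<in> cblinfun" "k \<in> cblinfun" "l \<in> cblinfun"
  shows "op_tensor a (k + l) = op_tensor a k + op_tensor a l"
  by (rule op_tensor_eqI)
    (simp_all add: assms cblinfun_add op_tensor(2) blinfun.add_left ell2_tensor_add_right)

lemma op_tensor_zero_left:
  assumes "k \<in> cblinfun"
  shows "op_tensor 0 k = 0"
  by (rule op_tensor_eqI)
    (simp_all add: assms complex_vector.subspace_0 [OF subspace_cblinfun] ell2_eqI
      ell2_tensor.rep_eq zero_ell2.rep_eq)

lemma op_tensor_zero_right:
  assumes "a \<in> cblinfun"
  shows "op_tensor a 0 = 0"
  by (rule op_tensor_eqI)
    (simp_all add: assms complex_vector.subspace_0 [OF subspace_cblinfun] ell2_eqI
      ell2_tensor.rep_eq zero_ell2.rep_eq)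

lemma op_tensor_sum_left:
  assumes "\<And>i. i \<in> I \<Longrightarrow> a i \<in> cblinfun" "k \<in> cblinfun"
  shows "op_tensor (\<Sum>i\<in>I. a i) k = (\<Sum>i\<in>I. op_tensor (a i) k)"
  using assms
  by (induction I rule: infinite_finite_induct)
    (simp_all add: op_tensor_add_left op_tensor_zero_left cblinfun_sum)

section \<open>Stability of compact operators under composition\<close>

lemma compact_op_cblinfun: "compact_op k \<Longrightarrow> k \<in> cblinfun"
  by (simp add: compact_op_def)

lemma compact_closure_subset:
  fixes A :: "'a::t2_space set"
  assumes "compact K" "A \<subseteq> K"
  shows "compact (closure A)"
proof -
  have "K \<inter> closure A = closure A"
    using closure_minimal [OF assms(2) compact_imp_closed [OF assms(1)]] by blast
  then show ?thesis using compact_Int_closed [OF assms(1) closed_closure, of A] by simp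
qed

lemma compact_op_compose_left:
  assumes w: "w \<in> cblinfun" and k: "compact_op k"
  shows "compact_op (w o\<^sub>L k)"
proof -
  have "compact (w ` closure (k ` cball 0 1))"
    using k by (intro compact_continuous_image linear_continuous_on blinfun.bounded_linear_right)
      (simp add: compact_op_def)
  moreover have "(w o\<^sub>L k) ` cball 0 1 \<subseteq> w ` closure (k ` cball 0 1)"
    using closure_subset [of "k ` cball 0 1"] by auto
  ultimately have "compact (closure ((w o\<^sub>L k) ` cball 0 1))"
    by (rule compact_closure_subset)
  then show ?thesis using w k by (simp add: compact_op_def cblinfun_compose)
qed

lemma compact_op_compose_right:
  fixes w :: "'a::chilbert_space \<Rightarrow>\<^sub>L 'b::chilbert_space"
    and k :: "'b \<Rightarrow>\<^sub>L 'c::chilbert_space"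
  assumes w: "w \<in> cblinfun" and k: "compact_op k"
  shows "compact_op (k o\<^sub>L w)"
proof -
  \<comment> \<open>The summand 1 keeps \<open>r\<close> positive even for \<open>w = 0\<close>, so
    that rescaling by \<open>inverse r\<close> moves the image of the unit ball under
    \<open>w\<close> back into the unit ball.\<close>
  define r where "r = norm w + 1"
  have r: "r > 0" by (simp add: r_def add_nonneg_pos)
  have sub: "(k o\<^sub>L w) ` cball 0 1 \<subseteq> (\<lambda>x. r *\<^sub>R x) ` closure (k ` cball 0 1)"
  proof clarify
    fix x :: 'a assume x: "x \<in> cball 0 1"
    have "norm (w x) \<le> norm w * norm x" by (rule norm_blinfun)
    also have "\<dots> \<le> norm w * 1" using x by (intro mult_left_mono) auto
    also have "\<dots> \<le> r" by (simp add: r_def)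
    finally have "norm (w x) \<le> r" .
    then have "inverse r *\<^sub>R w x \<in> cball 0 1" using r by (simp add: field_simps)
    then have "k (inverse r *\<^sub>R w x) \<in> closure (k ` cball 0 1)"
      by (intro subsetD [OF closure_subset] imageI)
    moreover have "(k o\<^sub>L w) x = r *\<^sub>R k (inverse r *\<^sub>R w x)" using r by (simp add: blinfun.scaleR_right)
    ultimately show "(k o\<^sub>L w) x \<in> (\<lambda>x. r *\<^sub>R x) ` closure (k ` cball 0 1)" by (rule image_eqI [rotated])
  qed
  have "compact ((\<lambda>x. r *\<^sub>R x) ` closure (k ` cball 0 1))"
    using k by (intro compact_scaling) (simp add: compact_op_def)
  then have "compact (closure ((k o\<^sub>L w) ` cball 0 1))" using sub by (rule compact_closure_subset)
  then show ?thesis using w k by (simp add: compact_op_def cblinfun_compose)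
qed

section \<open>Finite sums of tensors with coefficients in a set of operators\<close>

text \<open>No closure is taken, and the second leg may be any bounded operator, not only a compact
  one: the unitary is found among such finite sums, and compactness comes only from the operator it
  conjugates.\<close>

definition tensor_span ::
    "('a::chilbert_space \<Rightarrow>\<^sub>L 'b::chilbert_space) set \<Rightarrow> ('a ell2 \<Rightarrow>\<^sub>L 'b ell2) set"
  where "tensor_span M = complex_vector.span {op_tensor a v | a v. a \<in> M \<and> v \<in> cblinfun}"

lemma subspace_tensor_span: "complex_vector.subspace (tensor_span M)"
  by (simp add: tensor_span_def)

lemma tensor_span_base: "a \<in> M \<Longrightarrow> v \<in> cblinfun \<Longrightarrow> op_tensor a v \<in> tensor_span M"
  unfolding tensor_span_def by (rule complex_vector.span_base) blast

lemma tensor_span_subset: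
  assumes "complex_vector.subspace B" "\<And>a v. a \<in> M \<Longrightarrow> v \<in> cblinfun \<Longrightarrow> op_tensor a v \<in> B"
  shows "tensor_span M \<subseteq> B"
  unfolding tensor_span_def by (rule complex_vector.span_minimal) (use assms in auto)

lemma tensor_span_cblinfun: "M \<subseteq> cblinfun \<Longrightarrow> tensor_span M \<subseteq> cblinfun"
  by (rule tensor_span_subset [OF subspace_cblinfun]) (auto intro: op_tensor(1))

text \<open>Together with its mirror image this lets \<open>tensor_span_subset\<close> reduce a
  claim about products to elementary tensors, one factor at a time.\<close>

lemma subspace_compose_left:
  fixes Y :: "'a::complex_inner \<Rightarrow>\<^sub>L 'b::complex_inner" and B :: "('a \<Rightarrow>\<^sub>L 'c::complex_inner) set"
  assumes "complex_vector.subspace B"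
  shows "complex_vector.subspace {X. X o\<^sub>L Y \<in> B}"
  using assms unfolding complex_vector.subspace_def
  by (simp add: blinfun_compose_distribs blinfun_compose_scaleC(1))

lemma subspace_compose_right:
  assumes "complex_vector.subspace B" "X \<in> cblinfun"
  shows "complex_vector.subspace {Y. X o\<^sub>L Y \<in> B}"
  using assms unfolding complex_vector.subspace_def
  by (simp add: blinfun_compose_distribs blinfun_compose_scaleC)

lemma tensor_span_adj:
  assumes M: "M \<subseteq> cblinfun" and X: "X \<in> tensor_span M"
  shows "adj X \<in> tensor_span (adj ` M)"
proof -
  have "tensor_span M \<subseteq> {X. X \<in> cblinfun \<and> adj X \<in> tensor_span (adj ` M)}"
  proof (rule tensor_span_subset)
    show "complex_vector.subspace {X. X \<in> cblinfun \<and> adj X \<in> tensor_span (adj ` M)}"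
      using subspace_cblinfun [where 'a = "'a ell2" and 'b = "'b ell2"]
        subspace_tensor_span [of "adj ` M"]
      unfolding complex_vector.subspace_def by (simp add: adj_add adj_scaleC)
  next
    fix a :: "'a \<Rightarrow>\<^sub>L 'b" and v :: "complex ell2 \<Rightarrow>\<^sub>L complex ell2"
    assume "a \<in> M" "v \<in> cblinfun"
    moreover from this M have "a \<in> cblinfun" by auto
    ultimately show "op_tensor a v \<in> {X. X \<in> cblinfun \<and> adj X \<in> tensor_span (adj ` M)}"
      by (simp add: op_tensor(1) adj_op_tensor tensor_span_base)
  qed
  with X show ?thesis by auto
qed

lemma tensor_span_compose:
  assumes M: "M \<subseteq> cblinfun" and N: "N \<subseteq> cblinfun"
    and MN: "\<And>a b. a \<in> M \<Longrightarrow> b \<in> N \<Longrightarrow> a o\<^sub>L b \<in> P"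
    and X: "X \<in> tensor_span M" and Y: "Y \<in> tensor_span N"
  shows "X o\<^sub>L Y \<in> tensor_span P"
proof -
  have 1: "op_tensor a v o\<^sub>L op_tensor b w \<in> tensor_span P"
    if "a \<in> M" "v \<in> cblinfun" "b \<in> N" "w \<in> cblinfun" for a v b w
  proof -
    have "a \<in> cblinfun" "b \<in> cblinfun" using that M N by auto
    then show ?thesis using that by (simp add: op_tensor_compose tensor_span_base MN cblinfun_compose)
  qed
  have 2: "tensor_span N \<subseteq> {Y. op_tensor a v o\<^sub>L Y \<in> tensor_span P}"
    if "a \<in> M" "v \<in> cblinfun" for a v
  proof (rule tensor_span_subset)
    have "op_tensor a v \<in> cblinfun" using that M by (intro op_tensor(1)) auto
    then show "complex_vector.subspace {Y. op_tensor a v o\<^sub>L Y \<in> tensor_span P}"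
      by (rule subspace_compose_right [OF subspace_tensor_span])
  qed (use 1 that in simp)
  have "tensor_span M \<subseteq> {X. X o\<^sub>L Y \<in> tensor_span P}"
    by (rule tensor_span_subset [OF subspace_compose_left [OF subspace_tensor_span]]) (use 2 Y in auto)
  with X show ?thesis by auto
qed

text \<open>The ternary structure of \<open>M\<close> passes to its tensor span: first
  \<open>X o\<^sub>L adj Y\<close> has coefficients of the form \<open>a o\<^sub>L adj b\<close>,
  then multiplication by \<open>Z\<close> brings the coefficients back into
  \<open>M\<close>.\<close>

lemma tensor_span_triple:
  assumes M: "TRO M" and X: "X \<in> tensor_span M" "Y \<in> tensor_span M" "Z \<in> tensor_span M"
  shows "X o\<^sub>L adj Y o\<^sub>L Z \<in> tensor_span M"
proof -
  have Mc: "M \<subseteq> cblinfun" using M by (simp add: TRO_def)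
  have "X o\<^sub>L adj Y \<in> tensor_span {a o\<^sub>L adj b | a b. a \<in> M \<and> b \<in> M}"
    by (rule tensor_span_compose [OF Mc _ _ X(1) tensor_span_adj [OF Mc X(2)]]) (use Mc in auto)
  from tensor_span_compose [OF _ Mc _ this X(3), of M] show ?thesis
    using M Mc by (auto simp: TRO_def)
qed

lemma tensor_span_amplification:
  assumes M: "M \<subseteq> cblinfun" and X: "X \<in> tensor_span M" and v: "v \<in> cblinfun"
  shows "X o\<^sub>L op_tensor id_blinfun v \<in> tensor_span M"
    and "op_tensor id_blinfun v o\<^sub>L X \<in> tensor_span M"
  using M X v
  by (auto intro: tensor_span_compose [of M "{id_blinfun}" M] tensor_span_compose [of "{id_blinfun}" M M]
      tensor_span_base)

text \<open>On elementary tensors the first leg becomes \<open>a o\<^sub>L s o\<^sub>L b\<close>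
  with \<open>b\<close> an adjoint from \<open>M\<close>, hence lies in \<open>T\<close>, while the
  second leg stays compact under multiplication from both sides. Linearity and continuity do the
  rest.\<close>

lemma stabilization_conj:
  assumes M: "M \<subseteq> cblinfun" and S: "S \<subseteq> cblinfun"
    and MST: "\<And>a s b. a \<in> M \<Longrightarrow> s \<in> S \<Longrightarrow> b \<in> M \<Longrightarrow> a o\<^sub>L s o\<^sub>L adj b \<in> T"
    and U: "U \<in> tensor_span M" and X: "X \<in> stabilization S"
  shows "U o\<^sub>L X o\<^sub>L adj U \<in> stabilization T"
proof -
  have Uc: "U \<in> cblinfun" using tensor_span_cblinfun [OF M] U by blast
  have st: "complex_vector.subspace (stabilization T)"
    by (simp add: stabilization_def subspace_closed_cspan)
  have conj: "U o\<^sub>L (op_tensor s k o\<^sub>L adj U) \<in> stabilization T" if s: "s \<in> S" and k: "compact_op k" for s k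
  proof -
    have sc: "s \<in> cblinfun" and kc: "k \<in> cblinfun" using S s k by (auto simp: compact_op_cblinfun)
    have 1: "op_tensor a v o\<^sub>L (op_tensor s k o\<^sub>L op_tensor b w) \<in> stabilization T"
      if "a \<in> M" "v \<in> cblinfun" "b \<in> adj ` M" "w \<in> cblinfun" for a v b w
    proof -
      have "a \<in> cblinfun" "b \<in> cblinfun" using that M by auto
      then have "op_tensor a v o\<^sub>L (op_tensor s k o\<^sub>L op_tensor b w)
          = op_tensor (a o\<^sub>L s o\<^sub>L b) (v o\<^sub>L (k o\<^sub>L w))"
        using that sc kc by (simp add: op_tensor_compose cblinfun_compose blinfun_compose_assoc)
      moreover have "a o\<^sub>L s o\<^sub>L b \<in> T" using that MST s by auto
      moreover have "compact_op (v o\<^sub>L (k o\<^sub>L w))"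
        using that k by (intro compact_op_compose_left compact_op_compose_right)
      ultimately show ?thesis unfolding stabilization_def by (auto intro!: closed_cspan_base)
    qed
    have 2: "tensor_span (adj ` M) \<subseteq> {Z. op_tensor a v o\<^sub>L op_tensor s k o\<^sub>L Z \<in> stabilization T}"
      if "a \<in> M" "v \<in> cblinfun" for a v
    proof (rule tensor_span_subset)
      have "op_tensor a v o\<^sub>L op_tensor s k \<in> cblinfun"
        using that M sc kc by (intro cblinfun_compose op_tensor(1)) auto
      then show "complex_vector.subspace {Z. op_tensor a v o\<^sub>L op_tensor s k o\<^sub>L Z \<in> stabilization T}"
        by (rule subspace_compose_right [OF st])
    qed (use 1 that in \<open>simp add: blinfun_compose_assoc\<close>)
    \<comment> \<open>The conjugation is not linear in \<open>U\<close>. Its left factor is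
      therefore varied on its own, with the right factor \<open>adj U\<close> frozen.\<close>
    have "tensor_span M \<subseteq> {X. X o\<^sub>L (op_tensor s k o\<^sub>L adj U) \<in> stabilization T}"
      by (rule tensor_span_subset [OF subspace_compose_left [OF st]])
        (use 2 tensor_span_adj [OF M U] in \<open>auto simp: blinfun_compose_assoc\<close>)
    with U show ?thesis by auto
  qed
  show ?thesis
    unfolding stabilization_def [of T]
  proof (rule closed_cspan_image [where f = "\<lambda>X. U o\<^sub>L X o\<^sub>L adj U" and x = X])
    show "X \<in> closed_cspan {op_tensor s k | s k. s \<in> S \<and> compact_op k}"
      using X by (simp add: stabilization_def)
    show "bounded_linear (\<lambda>X. U o\<^sub>L X o\<^sub>L adj U)"
      by (intro bounded_linear_compose [OF bounded_bilinear.bounded_linear_left [OF bounded_bilinear_blinfun_compose]]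
        bounded_bilinear.bounded_linear_right [OF bounded_bilinear_blinfun_compose])
    show "U o\<^sub>L c *\<^sub>C X o\<^sub>L adj U = c *\<^sub>C (U o\<^sub>L X o\<^sub>L adj U)" for c X
      using Uc by (simp add: blinfun_compose_scaleC)
    show "{op_tensor s k | s k. s \<in> S \<and> compact_op k} \<subseteq> cblinfun"
      using S by (auto simp: compact_op_cblinfun intro!: op_tensor(1))
    show "U o\<^sub>L Y o\<^sub>L adj U \<in> closed_cspan {op_tensor s k | s k. s \<in> T \<and> compact_op k}"
      if "Y \<in> {op_tensor s k | s k. s \<in> S \<and> compact_op k}" for Y
      using that conj by (auto simp: stabilization_def blinfun_compose_assoc)
  qed
qed

section \<open>Isometries on the sequence space\<close>

lemma ell2_nth_eq_cinner: "ell2_nth x n = cinner (ell2_unit n) x" for x :: "complex ell2"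
  using cinner_adj_ell2_unit [OF cblinfun_id, of n x] by simp

text \<open>The pullback of sequences along \<open>g\<close> is easy to bound, since injectivity
  makes it a contraction. The isometry is the adjoint of the pullback, and its entries are read off
  from the images of unit vectors.\<close>

lemma ell2_reindex_isometry_ex:
  assumes g: "inj g"
  shows "\<exists>v :: complex ell2 \<Rightarrow>\<^sub>L complex ell2. v \<in> cblinfun \<and>
    (\<forall>x n. ell2_nth (v x) (g n) = ell2_nth x n) \<and>
    (\<forall>x n. n \<notin> range g \<longrightarrow> ell2_nth (v x) n = 0) \<and>
    (\<forall>x n. ell2_nth (adj v x) n = ell2_nth x (g n))"
proof -
  have "\<exists>A :: complex ell2 \<Rightarrow>\<^sub>L complex ell2. A \<in> cblinfun \<and> (\<forall>x n. ell2_nth (A x) n = ell2_nth x (g n))"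
    unfolding Bex_def [symmetric]
  proof (rule ell2_operator_ex [where C = 1])
    fix x :: "complex ell2" and N
    have "(\<Sum>n<N. (norm (ell2_nth x (g n)))\<^sup>2) = (\<Sum>n\<in>g ` {..<N}. (norm (ell2_nth x n))\<^sup>2)"
      using g by (simp add: sum.reindex inj_on_subset)
    also have "\<dots> \<le> (norm x)\<^sup>2"
      unfolding norm_ell2_sq by (intro sum_le_suminf summable_ell2) auto
    finally show "(\<Sum>n<N. (norm (ell2_nth x (g n)))\<^sup>2) \<le> (1 * norm x)\<^sup>2" by simp
  qed (simp_all add: plus_ell2.rep_eq scaleC_ell2.rep_eq)
  then obtain A :: "complex ell2 \<Rightarrow>\<^sub>L complex ell2" where A: "A \<in> cblinfun"
      "\<And>x n. ell2_nth (blinfun_apply A x) n = ell2_nth x (g n)"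
    by blast
  have nth: "ell2_nth (adj A x) n = cinner (A (ell2_unit n)) x" for x n
    by (simp add: ell2_nth_eq_cinner adj(2) [OF A(1)])
  have 1: "A (ell2_unit (g n)) = ell2_unit n" for n
    by (rule ell2_eqI) (simp add: A(2) inj_eq [OF g])
  have 2: "A (ell2_unit n) = 0" if "n \<notin> range g" for n
    using that by (intro ell2_eqI) (auto simp: A(2) zero_ell2.rep_eq)
  show ?thesis
    by (intro exI [of _ "adj A"]) (simp add: A nth 1 2 ell2_nth_eq_cinner [symmetric])
qed

text \<open>The pairing function splits the natural numbers into infinitely many disjoint copies of
  themselves, one for each first coordinate.\<close>

lemma orthogonal_isometries_ex:
  "\<exists>v :: nat \<Rightarrow> complex ell2 \<Rightarrow>\<^sub>L complex ell2.
    (\<forall>i. v i \<in> cblinfun) \<and> (\<forall>i j. adj (v i) o\<^sub>L v j = (if i = j then id_blinfun else 0))"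
proof -
  have "inj (\<lambda>n. prod_encode (i, n))" for i by (simp add: inj_def)
  from ell2_reindex_isometry_ex [OF this]
  obtain v :: "nat \<Rightarrow> complex ell2 \<Rightarrow>\<^sub>L complex ell2" where v: "\<And>i. v i \<in> cblinfun"
      "\<And>i x n. ell2_nth (v i x) (prod_encode (i, n)) = ell2_nth x n"
      "\<And>i x n. n \<notin> range (\<lambda>n. prod_encode (i, n)) \<Longrightarrow> ell2_nth (v i x) n = 0"
      "\<And>i x n. ell2_nth (adj (v i) x) n = ell2_nth x (prod_encode (i, n))"
    by metis
  have "prod_encode (i, n) \<notin> range (\<lambda>n. prod_encode (j, n))" if "i \<noteq> j" for i j n
    using that by auto
  then have "adj (v i) o\<^sub>L v j = (if i = j then id_blinfun else 0)" for i j
    by (intro blinfun_eqI ell2_eqI) (auto simp: v zero_ell2.rep_eq)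
  then show ?thesis using v(1) by blast
qed

text \<open>The even and the odd numbers are two disjoint copies of the natural numbers that
  together exhaust them, so the range projections add up to the identity.\<close>

lemma cuntz_isometries_ex:
  "\<exists>J\<in>cblinfun :: (complex ell2 \<Rightarrow>\<^sub>L complex ell2) set. \<exists>L\<in>cblinfun :: (complex ell2 \<Rightarrow>\<^sub>L complex ell2) set. adj J o\<^sub>L J = id_blinfun \<and> adj L o\<^sub>L L = id_blinfun \<and>
    (J o\<^sub>L adj J) + (L o\<^sub>L adj L) = id_blinfun"
proof -
  have inj: "inj (\<lambda>n::nat. 2 * n)" "inj (\<lambda>n::nat. Suc (2 * n))" by (auto simp: inj_def)
  obtain J :: "complex ell2 \<Rightarrow>\<^sub>L complex ell2" where J: "J \<in> cblinfun"
      "\<And>x n. ell2_nth (J x) (2 * n) = ell2_nth x n"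
      "\<And>x n. n \<notin> range (\<lambda>n. 2 * n) \<Longrightarrow> ell2_nth (J x) n = 0"
      "\<And>x n. ell2_nth (adj J x) n = ell2_nth x (2 * n)"
    using ell2_reindex_isometry_ex [OF inj(1)] by auto
  obtain L :: "complex ell2 \<Rightarrow>\<^sub>L complex ell2" where L: "L \<in> cblinfun"
      "\<And>x n. ell2_nth (L x) (Suc (2 * n)) = ell2_nth x n"
      "\<And>x n. n \<notin> range (\<lambda>n. Suc (2 * n)) \<Longrightarrow> ell2_nth (L x) n = 0"
      "\<And>x n. ell2_nth (adj L x) n = ell2_nth x (Suc (2 * n))"
    using ell2_reindex_isometry_ex [OF inj(2)] by auto
  have "(J o\<^sub>L adj J) + (L o\<^sub>L adj L) = id_blinfun"
  proof (intro blinfun_eqI ell2_eqI)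
    fix x n
    consider m where "n = 2 * m" | m where "n = Suc (2 * m)" by (metis evenE oddE Suc_eq_plus1)
    then show "ell2_nth (((J o\<^sub>L adj J) + (L o\<^sub>L adj L)) x) n = ell2_nth (id_blinfun x) n"
    proof cases
      case 1
      then have "n \<notin> range (\<lambda>n. Suc (2 * n))" by (auto, presburger)
      with 1 show ?thesis by (simp add: blinfun.add_left plus_ell2.rep_eq J L)
    next
      case 2
      then have "n \<notin> range (\<lambda>n. 2 * n)" by (auto, presburger)
      with 2 show ?thesis by (simp add: blinfun.add_left plus_ell2.rep_eq J L)
    qed
  qed
  moreover have "adj J o\<^sub>L J = id_blinfun" "adj L o\<^sub>L L = id_blinfun"
    by (intro blinfun_eqI ell2_eqI, simp add: J L)+
  ultimately show ?thesis using J(1) L(1) by blast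
qed

section \<open>Finite frames in ternary rings of operators\<close>

text \<open>The square root of \<open>p\<close> is \<open>1 - y\<close> for the fixed point \<open>y\<close> of the contraction
  \<open>y \<mapsto> (1 - p + y\<^sup>2) / 2\<close>; its inverse \<open>z\<close> is the fixed point of \<open>z \<mapsto> 1 + y z\<close>.\<close>

lemma inverse_sqrt_ex:
  fixes R :: "('a::chilbert_space \<Rightarrow>\<^sub>L 'a) set"
  assumes R: "R \<subseteq> cblinfun" "complex_vector.subspace R" "closed R" "id_blinfun \<in> R"
    and mult: "\<And>x y. x \<in> R \<Longrightarrow> y \<in> R \<Longrightarrow> x o\<^sub>L y \<in> R"
    and p: "p \<in> R" "adj p = p" "norm (id_blinfun - p) < 1"
  shows "\<exists>z\<in>R. adj z = z \<and> z o\<^sub>L p o\<^sub>L z = id_blinfun"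
proof -
  define x where "x = id_blinfun - p"
  \<comment> \<open>The midpoint of \<open>norm x\<close> and 1 satisfies
    \<open>norm x + r * r \<le> 2 * r\<close>, so the ball of radius \<open>r\<close> is mapped into
    itself by \<open>\<phi>\<close>. The same \<open>r\<close> is a contraction constant
    there.\<close>
  define r where "r = (1 + norm x) / 2"
  have nx: "norm x < 1" using p(3) by (simp add: x_def)
  have r: "0 \<le> r" "r < 1" using nx by (simp_all add: r_def)
  have xR: "x \<in> R" unfolding x_def by (intro complex_vector.subspace_diff R p)
  have pc: "p \<in> cblinfun" using p(1) R(1) by blast
  have xs: "adj x = x" by (simp add: x_def adj_diff p(2) pc)
  \<comment> \<open>Self-adjointness is built into the domain, so the fixed point inherits
    it.\<close>
  define Y where "Y = {y \<in> R. adj y = y} \<inter> cball 0 r"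
  have "closed {y \<in> R. adj y = y}"
    unfolding closed_sequential_limits
  proof clarify
    fix f l assume f: "\<forall>n. f n \<in> {y \<in> R. adj y = y}" and l: "f \<longlonglongrightarrow> l"
    have lR: "l \<in> R" using R(3) f l unfolding closed_sequential_limits by blast
    have "(\<lambda>n. adj (f n)) \<longlonglongrightarrow> adj l" using f R(1) lR by (intro tendsto_adj l) auto
    moreover have "(\<lambda>n. adj (f n)) = f" using f by auto
    ultimately have "adj l = l" using l LIMSEQ_unique by metis
    with lR show "l \<in> R \<and> adj l = l" by simp
  qed
  then have cY: "complete Y" unfolding Y_def complete_eq_closed by (intro closed_Int closed_cball)
  define \<phi> where "\<phi> y = (1/2) *\<^sub>R (x + (y o\<^sub>L y))" for y
  have "\<exists>!y\<in>Y. \<phi> y = y"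
  proof (rule Banach_fix [OF cY _ r])
    have "0 \<in> Y" using r by (simp add: Y_def complex_vector.subspace_0 [OF R(2)])
    then show "Y \<noteq> {}" by blast
    show "\<phi> ` Y \<subseteq> Y"
    proof clarify
      fix y assume "y \<in> Y"
      then have y: "y \<in> R" "adj y = y" "norm y \<le> r" by (auto simp: Y_def)
      then have yc: "y \<in> cblinfun" using R(1) by blast
      have xc: "x \<in> cblinfun" using xR R(1) by blast
      have "\<phi> y \<in> R" unfolding \<phi>_def
        by (intro subspace_scaleR [OF R(2)] complex_vector.subspace_add [OF R(2)] xR mult y)
      moreover have "adj (\<phi> y) = \<phi> y"
        using xc yc by (simp add: \<phi>_def adj_scaleR adj_add cblinfun_add cblinfun_compose adj_compose xs y(2))
      moreover have "norm (\<phi> y) \<le> r"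
      proof -
        have "norm (x + (y o\<^sub>L y)) \<le> norm x + norm y * norm y"
          by (rule order_trans [OF norm_triangle_ineq add_left_mono [OF norm_blinfun_compose]])
        also have "\<dots> \<le> norm x + r * r" using y(3) by (intro add_left_mono mult_mono) (simp_all add: r)
        also have "\<dots> \<le> 2 * r"
        proof -
          have "(1 - r)\<^sup>2 \<le> 1 - norm x"
          proof -
            have "(1 - norm x) * (1 - norm x) \<le> 1 * (1 - norm x)"
              using nx by (intro mult_right_mono) simp_all
            then show ?thesis using nx by (simp add: r_def power2_eq_square field_simps)
          qed
          then show ?thesis by (simp add: power2_eq_square algebra_simps)
        qed
        finally show ?thesis by (simp add: \<phi>_def)
      qed
      ultimately show "\<phi> y \<in> Y" by (simp add: Y_def)
    qed
    show "dist (\<phi> y) (\<phi> z) \<le> r * dist y z" if yz: "y \<in> Y" "z \<in> Y" for y z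
    proof -
      from yz have n: "norm y \<le> r" "norm z \<le> r" by (auto simp: Y_def)
      \<comment> \<open>This form of the difference of squares does not require \<open>y\<close> and
        \<open>z\<close> to commute.\<close>
      have "\<phi> y - \<phi> z = (1/2) *\<^sub>R ((y o\<^sub>L (y - z)) + ((y - z) o\<^sub>L z))"
        unfolding \<phi>_def by (simp add: scaleR_diff_right [symmetric] blinfun_compose_distribs)
      moreover have "norm ((y o\<^sub>L (y - z)) + ((y - z) o\<^sub>L z)) \<le> r * norm (y - z) + norm (y - z) * r"
        using n by (intro norm_triangle_mono order_trans [OF norm_blinfun_compose] mult_mono)
          (simp_all add: r)
      ultimately show ?thesis by (simp add: dist_norm)
    qed
  qed
  then obtain y where y: "y \<in> Y" "\<phi> y = y" by blast
  then have yR: "y \<in> R" "adj y = y" "norm y \<le> r" by (auto simp: Y_def)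
  then have yc: "y \<in> cblinfun" using R(1) by blast
  define s where "s = id_blinfun - y"
  have sc: "s \<in> cblinfun" and ss: "adj s = s" using yc yR(2) by (simp_all add: s_def adj_diff cblinfun_diff)
  have "x + (y o\<^sub>L y) = 2 *\<^sub>R y" using arg_cong [OF y(2), of "\<lambda>w. 2 *\<^sub>R w"] by (simp add: \<phi>_def)
  then have sp: "s o\<^sub>L s = p" by (simp add: s_def blinfun_compose_distribs x_def algebra_simps scaleR_2)
  have "\<exists>!z\<in>R. id_blinfun + (y o\<^sub>L z) = z"
  proof (rule Banach_fix [OF _ _ r])
    show "complete R" using R(3) by (simp add: complete_eq_closed)
    show "R \<noteq> {}" using R(4) by blast
    show "(\<lambda>z. id_blinfun + (y o\<^sub>L z)) ` R \<subseteq> R"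
      by (auto intro!: complex_vector.subspace_add [OF R(2)] R(4) mult yR)
    show "dist (id_blinfun + (y o\<^sub>L z)) (id_blinfun + (y o\<^sub>L w)) \<le> r * dist z w" for z w
    proof -
      have "norm (y o\<^sub>L (z - w)) \<le> r * norm (z - w)"
        using yR(3) by (intro order_trans [OF norm_blinfun_compose] mult_right_mono) auto
      then show ?thesis
        by (simp add: dist_norm blinfun_compose_distribs)
    qed
  qed
  then obtain z where z: "z \<in> R" "id_blinfun + (y o\<^sub>L z) = z" by blast
  have zc: "z \<in> cblinfun" using z(1) R(1) by blast
  have sz: "s o\<^sub>L z = id_blinfun"
    using z(2) by (simp add: s_def blinfun_compose_distribs) (metis add_diff_cancel_right')
  \<comment> \<open>The adjoint of a right inverse of the self-adjoint \<open>s\<close> is a left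
    inverse. The two coincide, which makes \<open>z\<close> self-adjoint.\<close>
  then have zs: "adj z o\<^sub>L s = id_blinfun"
    using adj_compose [OF sc zc] by (simp add: ss)
  have zz: "adj z = z"
    using zs sz by (metis blinfun_compose_assoc id_blinfun_compose)
  have "z o\<^sub>L p o\<^sub>L z = (z o\<^sub>L s) o\<^sub>L (s o\<^sub>L z)" by (simp only: sp [symmetric] blinfun_compose_assoc)
  also have "\<dots> = id_blinfun" using zs by (simp add: sz zz)
  finally show ?thesis using z(1) zz by blast
qed

text \<open>The left factors \<open>adj a\<close> and the scalars are absorbed into the constant
  \<open>C\<close>. Only the right factors remain, so mixed products
  \<open>adj a o\<^sub>L b\<close> can be traded for the positive ones
  \<open>adj b o\<^sub>L b\<close>.\<close>

lemma span_adj_compose_bound: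
  assumes M: "M \<subseteq> cblinfun"
    and x: "x \<in> complex_vector.span {adj a o\<^sub>L b | a b. a \<in> M \<and> b \<in> M}"
  shows "\<exists>B C. finite B \<and> B \<subseteq> M \<and> 0 \<le> C \<and> (\<forall>h. norm (x h) \<le> C * (\<Sum>b\<in>B. norm (blinfun_apply b h)))"
  using x
proof (induction rule: complex_vector.span_induct_alt)
  case base
  show ?case by (intro exI [of _ "{}"] exI [of _ 0]) simp
next
  case (step c w y)
  then obtain a b where ab: "w = adj a o\<^sub>L b" "a \<in> M" "b \<in> M" by blast
  from step obtain B C where B: "finite B" "B \<subseteq> M" "0 \<le> C" "\<And>h. norm (y h) \<le> C * (\<Sum>b\<in>B. norm (blinfun_apply b h))"
    by blast
  define D where "D = cmod c * norm (adj a) + C"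
  have D: "0 \<le> D" by (simp add: D_def B(3))
  have "norm ((c *\<^sub>C w + y) h) \<le> D * (\<Sum>b\<in>insert b B. norm (blinfun_apply b h))" for h
  proof -
    have "norm ((c *\<^sub>C w + y) h) \<le> cmod c * norm (w h) + norm (y h)"
      by (simp add: blinfun.add_left scaleC_blinfun.rep_eq) (metis norm_scaleC norm_triangle_ineq)
    also have "\<dots> \<le> cmod c * (norm (adj a) * norm (blinfun_apply b h)) + C * (\<Sum>b\<in>B. norm (blinfun_apply b h))"
      by (intro add_mono mult_left_mono B(4)) (simp_all add: ab(1) norm_blinfun)
    also have "\<dots> \<le> cmod c * (norm (adj a) * (\<Sum>b\<in>insert b B. norm (blinfun_apply b h)))
        + C * (\<Sum>b\<in>insert b B. norm (blinfun_apply b h))"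
      using B(1) by (intro add_mono mult_left_mono sum_mono2 B(3) member_le_sum) auto
    finally show ?thesis by (simp add: D_def algebra_simps)
  qed
  then show ?case using B D ab(3) by (intro exI [of _ "insert b B"] exI [of _ D]) auto
qed

text \<open>An element of the span close to the identity is bounded below; by the preceding estimate
  so is the quadratic form of \<open>p\<close>. After rescaling, \<open>p\<close> is close enough to
  the identity to have an inverse square root, which normalizes the elements of
  \<open>B\<close>.\<close>

lemma TRO_frame_ex:
  fixes M :: "('a::chilbert_space \<Rightarrow>\<^sub>L 'b::chilbert_space) set"
  assumes M: "TRO M" "closed M"
    and id: "id_blinfun \<in> closed_cspan {adj a o\<^sub>L b | a b. a \<in> M \<and> b \<in> M}"
  shows "\<exists>(n::nat) c. (\<forall>i<n. c i \<in> M) \<and> (\<Sum>i<n. adj (c i) o\<^sub>L c i) = id_blinfun"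
proof -
  have Mc: "M \<subseteq> cblinfun" "complex_vector.subspace M"
    and tro: "\<And>a b c. a \<in> M \<Longrightarrow> b \<in> M \<Longrightarrow> c \<in> M \<Longrightarrow> a o\<^sub>L adj b o\<^sub>L c \<in> M"
    using M(1) by (auto simp: TRO_def)
  obtain x where x: "x \<in> complex_vector.span {adj a o\<^sub>L b | a b. a \<in> M \<and> b \<in> M}"
      "dist x id_blinfun < 1/2"
    using id [unfolded closed_cspan_def closure_approachable, rule_format, of "1/2"]
    by (auto simp del: mem_Collect_eq)
  obtain B C where B: "finite B" "B \<subseteq> M" "0 \<le> C" "\<And>h. norm (x h) \<le> C * (\<Sum>b\<in>B. norm (blinfun_apply b h))"
    using span_adj_compose_bound [OF Mc(1) x(1)] by blast
  have Bc: "b \<in> cblinfun" if "b \<in> B" for b using that B(2) Mc(1) by blast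
  define p where "p = (\<Sum>b\<in>B. adj b o\<^sub>L b)"
  have pc: "p \<in> cblinfun" unfolding p_def by (intro cblinfun_sum cblinfun_compose adj_cblinfun Bc)
  have ps: "adj p = p"
    unfolding p_def by (simp add: adj_sum Bc cblinfun_compose adj_compose)
  \<comment> \<open>The main term comes from squaring \<open>norm h \<le> 2 * norm (x h)\<close> and
    applying Cauchy-Schwarz to the sum over \<open>B\<close>. The summand 1 ensures positivity, also
    for empty \<open>B\<close>.\<close>
  define D where "D = 4 * C\<^sup>2 * real (card B) + 1"
  have D: "D > 0" by (simp add: D_def add_nonneg_pos)
  have ph: "inner h (p h) = (\<Sum>b\<in>B. (norm (blinfun_apply b h))\<^sup>2)" for h
  proof -
    have "inner h (p h) = (\<Sum>b\<in>B. Re (cinner h (adj b (blinfun_apply b h))))"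
      by (simp add: p_def blinfun.sum_left inner_eq_Re_cinner cinner_sum_right)
    also have "\<dots> = (\<Sum>b\<in>B. (norm (blinfun_apply b h))\<^sup>2)"
      by (intro sum.cong refl) (simp add: adj(2) [OF Bc, symmetric] cinner_self del: of_real_power)
    finally show ?thesis .
  qed
  have lower: "(norm h)\<^sup>2 \<le> D * inner h (p h)" for h
  proof -
    have "norm ((x - id_blinfun) h) \<le> norm (x - id_blinfun) * norm h" by (rule norm_blinfun)
    also have "\<dots> \<le> (1/2) * norm h" using x(2) by (intro mult_right_mono) (simp_all add: dist_norm)
    finally have "norm h \<le> 2 * norm (x h)"
      using norm_triangle_ineq2 [of h "x h"] by (simp add: blinfun.diff_left norm_minus_commute)
    also have "\<dots> \<le> 2 * (C * (\<Sum>b\<in>B. norm (blinfun_apply b h)))" using B(4) [of h] by simp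
    finally have "(norm h)\<^sup>2 \<le> (2 * (C * (\<Sum>b\<in>B. norm (blinfun_apply b h))))\<^sup>2" by (intro power_mono) simp_all
    also have "\<dots> = 4 * C\<^sup>2 * (\<Sum>b\<in>B. norm (blinfun_apply b h))\<^sup>2" by (simp add: power_mult_distrib)
    also have "\<dots> \<le> 4 * C\<^sup>2 * ((\<Sum>b\<in>B. (norm (blinfun_apply b h))\<^sup>2) * real (card B))"
      by (intro mult_left_mono sum_squared_le_sum_of_squares) simp
    also have "\<dots> \<le> D * inner h (p h)" by (simp add: D_def ph algebra_simps sum_nonneg)
    finally show ?thesis .
  qed
  \<comment> \<open>Here \<open>\<epsilon>\<close> bounds the form of \<open>p\<close> from below
    and \<open>\<Lambda>\<close> bounds its norm. The choice of \<open>t\<close> minimizes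
    \<open>1 - 2 * t * \<epsilon> + t\<^sup>2 * \<Lambda>\<^sup>2\<close>, and \<open>q\<close> is
    the minimum. Adding \<open>\<epsilon>\<close> to \<open>norm p\<close> gives
    \<open>\<epsilon> \<le> \<Lambda>\<close>, hence \<open>0 \<le> q\<close>.\<close>
  define \<epsilon> where "\<epsilon> = 1 / D"
  define \<Lambda> where "\<Lambda> = norm p + \<epsilon>"
  define t where "t = \<epsilon> / \<Lambda>\<^sup>2"
  define q where "q = 1 - (\<epsilon> / \<Lambda>)\<^sup>2"
  have \<epsilon>: "\<epsilon> > 0" using D by (simp add: \<epsilon>_def)
  have \<Lambda>: "\<Lambda> > 0" "\<epsilon> \<le> \<Lambda>" "norm p \<le> \<Lambda>" using \<epsilon> by (simp_all add: \<Lambda>_def add_nonneg_pos)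
  have t: "t > 0" using \<epsilon> \<Lambda> by (simp add: t_def)
  have q: "0 \<le> q" "q < 1" using \<epsilon> \<Lambda> by (simp_all add: q_def power_le_one)
  have "norm (id_blinfun - t *\<^sub>R p) \<le> sqrt q"
  proof (rule norm_blinfun_bound)
    fix h
    have "(norm (h - t *\<^sub>R p h))\<^sup>2 = (norm h)\<^sup>2 + (norm (t *\<^sub>R p h))\<^sup>2 - 2 * inner h (t *\<^sub>R p h)"
      by (simp only: power2_norm_eq_inner inner_diff_left inner_diff_right)
        (simp add: inner_commute)
    then have "(norm ((id_blinfun - t *\<^sub>R p) h))\<^sup>2 = (norm h)\<^sup>2 - 2 * t * inner h (p h) + t\<^sup>2 * (norm (p h))\<^sup>2"
      by (simp add: blinfun.diff_left blinfun.scaleR_left power_mult_distrib)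
    also have "\<dots> \<le> (norm h)\<^sup>2 - 2 * t * (\<epsilon> * (norm h)\<^sup>2) + t\<^sup>2 * (\<Lambda> * norm h)\<^sup>2"
    proof (intro add_mono diff_mono mult_left_mono power_mono order_refl)
      show "\<epsilon> * (norm h)\<^sup>2 \<le> inner h (p h)" using lower [of h] D by (simp add: \<epsilon>_def field_simps)
      show "norm (p h) \<le> \<Lambda> * norm h"
        by (rule order_trans [OF norm_blinfun mult_right_mono [OF \<Lambda>(3)]]) simp
    qed (use t in simp_all)
    also have "\<dots> = q * (norm h)\<^sup>2"
    proof -
      have 1: "t * \<Lambda>\<^sup>2 = \<epsilon>" using \<Lambda>(1) by (simp add: t_def)
      have "t\<^sup>2 * (\<Lambda> * norm h)\<^sup>2 = (t * \<Lambda>\<^sup>2) * t * (norm h)\<^sup>2"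
        by (simp add: power2_eq_square mult_ac)
      moreover have "q = 1 - t * \<epsilon>" by (simp add: q_def t_def power_divide power2_eq_square)
      ultimately show ?thesis unfolding 1 by (simp add: left_diff_distrib mult_ac)
    qed
    also have "\<dots> = (sqrt q * norm h)\<^sup>2" using q by (simp add: power_mult_distrib)
    finally show "norm ((id_blinfun - t *\<^sub>R p) h) \<le> sqrt q * norm h"
      by (rule power2_le_imp_le) (simp add: q)
  qed (use q in simp)
  also have "sqrt q < 1" using q by simp
  finally have small: "norm (id_blinfun - t *\<^sub>R p) < 1" .
  \<comment> \<open>The right multipliers of \<open>M\<close> replace the closed span of \<open>M\<^sup>*M\<close>: they are visibly a closed algebra.\<close>
  define R where "R = {z \<in> cblinfun. \<forall>a\<in>M. a o\<^sub>L z \<in> M}"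
  have "\<exists>z\<in>R. adj z = z \<and> z o\<^sub>L (t *\<^sub>R p) o\<^sub>L z = id_blinfun"
  proof (rule inverse_sqrt_ex [OF _ _ _ _ _ _ _ small])
    show "R \<subseteq> cblinfun" "id_blinfun \<in> R" by (auto simp: R_def)
    show sR: "complex_vector.subspace R"
      unfolding complex_vector.subspace_def
    proof (intro conjI ballI allI)
      show "0 \<in> R"
        by (simp add: R_def complex_vector.subspace_0 [OF subspace_cblinfun] complex_vector.subspace_0 [OF Mc(2)])
      fix y w :: "'a \<Rightarrow>\<^sub>L 'a" and d assume y: "y \<in> R"
      show "y + w \<in> R" if "w \<in> R"
        using y that
        by (simp add: R_def cblinfun_add blinfun_compose_distribs complex_vector.subspace_add [OF Mc(2)])
      have "a o\<^sub>L d *\<^sub>C y \<in> M" if "a \<in> M" for a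
      proof -
        have "a \<in> cblinfun" using that Mc(1) by blast
        then show ?thesis
          using that y by (simp add: R_def blinfun_compose_scaleC(2) complex_vector.subspace_scale [OF Mc(2)])
      qed
      then show "d *\<^sub>C y \<in> R"
        using y by (simp add: R_def complex_vector.subspace_scale [OF subspace_cblinfun])
    qed
    have "R = cblinfun \<inter> (\<Inter>a\<in>M. (\<lambda>z. a o\<^sub>L z) -` M)" by (auto simp: R_def)
    moreover have "closed ((\<lambda>z :: 'a \<Rightarrow>\<^sub>L 'a. a o\<^sub>L z) -` M)" for a
      by (intro continuous_closed_vimage M(2) linear_continuous_at
          bounded_bilinear.bounded_linear_right [OF bounded_bilinear_blinfun_compose])
    ultimately show "closed R" by (simp add: closed_INT closed_Int closed_cblinfun)
    show "x o\<^sub>L y \<in> R" if "x \<in> R" "y \<in> R" for x y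
      using that by (auto simp: R_def blinfun_compose_assoc [symmetric])
    \<comment> \<open>The ternary property enters here: every summand
      \<open>a o\<^sub>L adj b o\<^sub>L b\<close> is a triple product.\<close>
    have "a o\<^sub>L p \<in> M" if "a \<in> M" for a
    proof -
      have "a o\<^sub>L p = (\<Sum>b\<in>B. a o\<^sub>L adj b o\<^sub>L b)"
        by (simp add: p_def blinfun_compose_sum blinfun_compose_assoc)
      also have "\<dots> \<in> M"
        using that B(2) by (intro complex_vector.subspace_sum [OF Mc(2)] tro) auto
      finally show ?thesis .
    qed
    then have "p \<in> R" using pc by (simp add: R_def)
    then show "t *\<^sub>R p \<in> R" by (rule subspace_scaleR [OF sR])
    show "adj (t *\<^sub>R p) = t *\<^sub>R p" by (simp add: adj_scaleR pc ps)
  qed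
  then obtain z where z: "z \<in> R" "adj z = z" "z o\<^sub>L (t *\<^sub>R p) o\<^sub>L z = id_blinfun" by blast
  have zc: "z \<in> cblinfun" and zM: "\<And>a. a \<in> M \<Longrightarrow> a o\<^sub>L z \<in> M" using z(1) by (auto simp: R_def)
  \<comment> \<open>Numbering \<open>B\<close> lets each frame element later be paired with its own
    isometry of the sequence space.\<close>
  obtain e :: "nat \<Rightarrow> 'a \<Rightarrow>\<^sub>L 'b" where e: "bij_betw e {..<card B} B"
    using ex_bij_betw_nat_finite [OF B(1)] by (auto simp: atLeast0LessThan)
  define c where "c i = sqrt t *\<^sub>R (e i o\<^sub>L z)" for i
  have eB: "e i \<in> B" if "i < card B" for i using e that by (auto simp: bij_betw_def)
  have "c i \<in> M" if "i < card B" for i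
    unfolding c_def using eB [OF that] B(2) by (intro subspace_scaleR [OF Mc(2)] zM) auto
  moreover have "(\<Sum>i<card B. adj (c i) o\<^sub>L c i) = id_blinfun"
  proof -
    have "adj (sqrt t *\<^sub>R (b o\<^sub>L z)) o\<^sub>L sqrt t *\<^sub>R (b o\<^sub>L z) = z o\<^sub>L (t *\<^sub>R (adj b o\<^sub>L b)) o\<^sub>L z"
      if "b \<in> B" for b
    proof (rule blinfun_eqI)
      fix h
      have "adj (sqrt t *\<^sub>R (b o\<^sub>L z)) = sqrt t *\<^sub>R (z o\<^sub>L adj b)"
        using Bc [OF that] zc by (simp add: adj_scaleR adj_compose cblinfun_compose z(2))
      then show "(adj (sqrt t *\<^sub>R (b o\<^sub>L z)) o\<^sub>L sqrt t *\<^sub>R (b o\<^sub>L z)) h = (z o\<^sub>L (t *\<^sub>R (adj b o\<^sub>L b)) o\<^sub>L z) h"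
        using t by (simp add: blinfun.scaleR_left blinfun.scaleR_right)
    qed
    then have "(\<Sum>i<card B. adj (c i) o\<^sub>L c i) = (\<Sum>i<card B. z o\<^sub>L (t *\<^sub>R (adj (e i) o\<^sub>L e i)) o\<^sub>L z)"
      unfolding c_def using eB by (intro sum.cong) auto
    also have "\<dots> = (\<Sum>b\<in>B. z o\<^sub>L (t *\<^sub>R (adj b o\<^sub>L b)) o\<^sub>L z)"
      by (rule sum.reindex_bij_betw [OF e])
    also have "\<dots> = z o\<^sub>L (t *\<^sub>R p) o\<^sub>L z"
      by (simp add: p_def scaleR_right.sum blinfun_compose_sum)
    finally show ?thesis using z(3) by simp
  qed
  ultimately show ?thesis by blast
qed

section \<open>The unitary\<close>

text \<open>The range of \<open>V\<close> splits into two copies of itself, and \<open>Y\<close> moves everything off the first one.\<close>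

lemma isometry_absorption:
  fixes V :: "'a::chilbert_space \<Rightarrow>\<^sub>L 'b::chilbert_space" and J L :: "'a \<Rightarrow>\<^sub>L 'a"
  assumes c: "V \<in> cblinfun" "J \<in> cblinfun" "L \<in> cblinfun"
    and V: "adj V o\<^sub>L V = id_blinfun" and J: "adj J o\<^sub>L J = id_blinfun" and L: "adj L o\<^sub>L L = id_blinfun"
    and JL: "(J o\<^sub>L adj J) + (L o\<^sub>L adj L) = id_blinfun"
  defines "X \<equiv> V o\<^sub>L J" and "Y \<equiv> id_blinfun - (V o\<^sub>L adj V) + (V o\<^sub>L L o\<^sub>L adj V)"
  shows "adj X o\<^sub>L X = id_blinfun" "adj Y o\<^sub>L Y = id_blinfun"
    "(X o\<^sub>L adj X) + (Y o\<^sub>L adj Y) = id_blinfun"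
proof -
  have V': "adj V o\<^sub>L (V o\<^sub>L w) = w" for w :: "'c::real_normed_vector \<Rightarrow>\<^sub>L 'a"
    using V by (simp add: blinfun_compose_assoc [symmetric])
  have L': "adj L o\<^sub>L (L o\<^sub>L w) = w" for w :: "'c::real_normed_vector \<Rightarrow>\<^sub>L 'a"
    using L by (simp add: blinfun_compose_assoc [symmetric])
  \<comment> \<open>Eliminating the range projection of \<open>J\<close> in favour of that of
    \<open>L\<close> makes the terms of \<open>X o\<^sub>L adj X\<close> and
    \<open>Y o\<^sub>L adj Y\<close> cancel. The trailing \<open>w\<close> lets the rule fire inside
    right-nested products.\<close>
  have JL': "J o\<^sub>L (adj J o\<^sub>L w) = w - (L o\<^sub>L (adj L o\<^sub>L w))" for w :: "'c::real_normed_vector \<Rightarrow>\<^sub>L 'a"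
  proof -
    have "(J o\<^sub>L (adj J o\<^sub>L w)) + (L o\<^sub>L (adj L o\<^sub>L w)) = ((J o\<^sub>L adj J) + (L o\<^sub>L adj L)) o\<^sub>L w"
      by (simp add: blinfun_compose_distribs blinfun_compose_assoc)
    then show ?thesis by (simp add: JL eq_diff_eq)
  qed
  have Xa: "adj X = adj J o\<^sub>L adj V" using c by (simp add: X_def adj_compose)
  have Ya: "adj Y = id_blinfun - (V o\<^sub>L adj V) + (V o\<^sub>L (adj L o\<^sub>L adj V))"
    using c by (simp add: Y_def adj_add adj_diff adj_compose cblinfun_add cblinfun_diff cblinfun_compose)
  show "adj X o\<^sub>L X = id_blinfun"
    unfolding Xa by (simp add: X_def blinfun_compose_assoc V' J)
  show "adj Y o\<^sub>L Y = id_blinfun"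
    unfolding Ya by (simp add: Y_def blinfun_compose_assoc blinfun_compose_distribs V' L' V)
  show "(X o\<^sub>L adj X) + (Y o\<^sub>L adj Y) = id_blinfun"
    unfolding Xa Ya by (simp add: X_def Y_def blinfun_compose_assoc blinfun_compose_distribs V' JL')
qed

text \<open>Multiplying \<open>XY\<close> by \<open>adj X\<close> on the left leaves
  \<open>adj X o\<^sub>L Y o\<^sub>L adj Y = 0\<close>, and the isometry \<open>Y\<close> then
  cancels \<open>adj Y\<close>.\<close>

lemma orthogonal_complement_isometries:
  fixes X :: "'a::chilbert_space \<Rightarrow>\<^sub>L 'c::chilbert_space" and Y :: "'b::chilbert_space \<Rightarrow>\<^sub>L 'c"
  assumes c: "X \<in> cblinfun" "Y \<in> cblinfun"
    and X: "adj X o\<^sub>L X = id_blinfun" and Y: "adj Y o\<^sub>L Y = id_blinfun"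
    and XY: "(X o\<^sub>L adj X) + (Y o\<^sub>L adj Y) = id_blinfun"
  shows "adj X o\<^sub>L Y = 0" "adj Y o\<^sub>L X = 0"
proof -
  have "adj X o\<^sub>L ((X o\<^sub>L adj X) + (Y o\<^sub>L adj Y)) = (adj X o\<^sub>L X o\<^sub>L adj X) + (adj X o\<^sub>L Y o\<^sub>L adj Y)"
    by (simp add: blinfun_compose_distribs blinfun_compose_assoc)
  then have "adj X o\<^sub>L Y o\<^sub>L adj Y = 0" by (simp add: XY X)
  then have "adj X o\<^sub>L Y o\<^sub>L adj Y o\<^sub>L Y = 0" by simp
  then show *: "adj X o\<^sub>L Y = 0" by (simp add: blinfun_compose_assoc Y)
  show "adj Y o\<^sub>L X = 0"
    using arg_cong [OF *, of adj] c by (simp add: adj_compose)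
qed

text \<open>Each pair identifies its target with the direct sum of the two spaces. The operator
  undoes the identification given by \<open>Y'\<close> and \<open>X'\<close> and applies the one
  given by \<open>X\<close> and \<open>Y\<close>; all cross terms vanish by orthogonality of the
  ranges.\<close>

lemma unitary_of_decompositions:
  fixes X :: "'a::chilbert_space \<Rightarrow>\<^sub>L 'b::chilbert_space" and Y :: "'b \<Rightarrow>\<^sub>L 'b"
    and X' :: "'b \<Rightarrow>\<^sub>L 'a" and Y' :: "'a \<Rightarrow>\<^sub>L 'a"
  assumes c: "X \<in> cblinfun" "Y \<in> cblinfun" "X' \<in> cblinfun" "Y' \<in> cblinfun"
    and X: "adj X o\<^sub>L X = id_blinfun" and Y: "adj Y o\<^sub>L Y = id_blinfun"
    and XY: "(X o\<^sub>L adj X) + (Y o\<^sub>L adj Y) = id_blinfun"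
    and X': "adj X' o\<^sub>L X' = id_blinfun" and Y': "adj Y' o\<^sub>L Y' = id_blinfun"
    and XY': "(X' o\<^sub>L adj X') + (Y' o\<^sub>L adj Y') = id_blinfun"
  shows "unitary ((X o\<^sub>L adj Y') + (Y o\<^sub>L adj X'))"
proof -
  have cancel: "a o\<^sub>L (b o\<^sub>L w) = w" if "a o\<^sub>L b = id_blinfun"
    for a :: "'d::chilbert_space \<Rightarrow>\<^sub>L 'c::chilbert_space" and b and w :: "'e::chilbert_space \<Rightarrow>\<^sub>L 'c"
    using that by (simp add: blinfun_compose_assoc [symmetric])
  have kill: "a o\<^sub>L (b o\<^sub>L w) = 0" if "a o\<^sub>L b = 0"
    for a :: "'d::chilbert_space \<Rightarrow>\<^sub>L 'c::chilbert_space"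
      and b :: "'f::chilbert_space \<Rightarrow>\<^sub>L 'd" and w :: "'e::chilbert_space \<Rightarrow>\<^sub>L 'f"
    using that by (simp add: blinfun_compose_assoc [symmetric])
  note simps = cancel [OF X] cancel [OF Y] cancel [OF X'] cancel [OF Y']
    orthogonal_complement_isometries [OF c(1,2) X Y XY, THEN kill]
    orthogonal_complement_isometries [OF c(3,4) X' Y' XY', THEN kill]
  have Ua: "adj ((X o\<^sub>L adj Y') + (Y o\<^sub>L adj X')) = (Y' o\<^sub>L adj X) + (X' o\<^sub>L adj Y)"
    using c by (simp add: adj_add adj_compose cblinfun_compose)
  have "(X o\<^sub>L adj Y') + (Y o\<^sub>L adj X') \<in> cblinfun"
    using c by (intro cblinfun_add cblinfun_compose adj_cblinfun)
  moreover have "((Y' o\<^sub>L adj X) + (X' o\<^sub>L adj Y)) o\<^sub>L ((X o\<^sub>L adj Y') + (Y o\<^sub>L adj X')) = id_blinfun"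
    using XY' by (simp add: blinfun_compose_distribs blinfun_compose_assoc simps add.commute)
  moreover have "((X o\<^sub>L adj Y') + (Y o\<^sub>L adj X')) o\<^sub>L ((Y' o\<^sub>L adj X) + (X' o\<^sub>L adj Y)) = id_blinfun"
    using XY by (simp add: blinfun_compose_distribs blinfun_compose_assoc simps)
  ultimately show ?thesis unfolding unitary_def Ua by blast
qed

section \<open>Isometries and the unitary inside the tensor span\<close>

text \<open>Orthogonality of the ranges of the \<open>v i\<close> removes the mixed terms of
  \<open>adj V o\<^sub>L V\<close>, so only the frame identity tensored with the identity is
  left.\<close>

lemma tensor_span_isometry_ex:
  fixes M :: "('a::chilbert_space \<Rightarrow>\<^sub>L 'b::chilbert_space) set"
  assumes M: "TRO M" "closed M"
    and id: "id_blinfun \<in> closed_cspan {adj a o\<^sub>L b | a b. a \<in> M \<and> b \<in> M}"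
  shows "\<exists>V\<in>tensor_span M. adj V o\<^sub>L V = id_blinfun"
proof -
  obtain n :: nat and c where c: "\<And>i. i < n \<Longrightarrow> c i \<in> M" "(\<Sum>i<n. adj (c i) o\<^sub>L c i) = id_blinfun"
    using TRO_frame_ex [OF M id] by blast
  obtain v :: "nat \<Rightarrow> complex ell2 \<Rightarrow>\<^sub>L complex ell2" where v: "\<And>i. v i \<in> cblinfun"
    "\<And>i j. adj (v i) o\<^sub>L v j = (if i = j then id_blinfun else 0)"
    using orthogonal_isometries_ex by blast
  have cc: "c i \<in> cblinfun" if "i < n" for i using c(1) [OF that] M(1) by (auto simp: TRO_def)
  define V where "V = (\<Sum>i<n. op_tensor (c i) (v i))"
  have "V \<in> tensor_span M"
    unfolding V_def
    by (intro complex_vector.subspace_sum [OF subspace_tensor_span] tensor_span_base) (simp_all add: c v)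
  have "adj V = (\<Sum>i<n. op_tensor (adj (c i)) (adj (v i)))"
    unfolding V_def by (subst adj_sum) (auto simp: cc v(1) op_tensor(1) adj_op_tensor)
  then have "adj V o\<^sub>L V = (\<Sum>i<n. \<Sum>j<n. op_tensor (adj (c i) o\<^sub>L c j) (adj (v i) o\<^sub>L v j))"
    by (simp add: V_def blinfun_compose_sum op_tensor_compose cc v(1)) (rule sum.swap)
  also have "\<dots> = (\<Sum>i<n. \<Sum>j<n. if i = j then op_tensor (adj (c i) o\<^sub>L c j) id_blinfun else 0)"
    by (intro sum.cong refl) (auto simp: v(2) op_tensor_zero_right cc cblinfun_compose)
  also have "\<dots> = (\<Sum>i<n. op_tensor (adj (c i) o\<^sub>L c i) id_blinfun)" by simp
  also have "\<dots> = id_blinfun"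
    by (subst op_tensor_sum_left [symmetric]) (auto simp: c(2) cc op_tensor_id intro: cblinfun_compose)
  finally show ?thesis using \<open>V \<in> tensor_span M\<close> by blast
qed

lemma tensor_span_unitary_ex:
  fixes M :: "('a::chilbert_space \<Rightarrow>\<^sub>L 'b::chilbert_space) set"
  assumes M: "TRO M" "closed M"
    and id1: "id_blinfun \<in> closed_cspan {adj a o\<^sub>L b | a b. a \<in> M \<and> b \<in> M}"
    and id2: "id_blinfun \<in> closed_cspan {a o\<^sub>L adj b | a b. a \<in> M \<and> b \<in> M}"
  shows "\<exists>U\<in>tensor_span M. unitary U"
proof -
  have Mc: "M \<subseteq> cblinfun" using M(1) by (simp add: TRO_def)
  have adj_adj_M: "adj (adj a) = a" if "a \<in> M" for a using that Mc by auto
  then have adjadj: "adj ` adj ` M = M" by (simp add: image_image)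
  have cl: "closed (adj ` M)"
    unfolding closed_sequential_limits
  proof clarify
    fix f l assume f: "\<forall>n. f n \<in> adj ` M" and l: "f \<longlonglongrightarrow> l"
    have fc: "f n \<in> cblinfun" for n
    proof -
      obtain a where "a \<in> M" "f n = adj a" using f by blast
      then show ?thesis using Mc by auto
    qed
    have lc: "l \<in> cblinfun" by (rule closed_sequentially [OF closed_cblinfun fc l])
    have "adj (f n) \<in> M" for n using f adjadj by blast
    moreover have "(\<lambda>n. adj (f n)) \<longlonglongrightarrow> adj l" by (rule tendsto_adj [OF fc l lc])
    ultimately have "adj l \<in> M" by (rule closed_sequentially [OF M(2)])
    then show "l \<in> adj ` M" using lc by (intro image_eqI [of _ _ "adj l"]) simp_all
  qed
  have eq: "{adj a o\<^sub>L b | a b. a \<in> adj ` M \<and> b \<in> adj ` M} = {a o\<^sub>L adj b | a b. a \<in> M \<and> b \<in> M}"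
    (is "?A = ?B")
  proof -
    have "?B = {adj (adj a) o\<^sub>L adj b | a b. a \<in> M \<and> b \<in> M}"
      by (intro Collect_cong ex_cong1) (auto simp: adj_adj_M)
    also have "\<dots> = ?A" by blast
    finally show ?thesis by (rule sym)
  qed
  obtain V where V: "V \<in> tensor_span M" "adj V o\<^sub>L V = id_blinfun"
    using tensor_span_isometry_ex [OF M id1] by blast
  obtain W0 where W0: "W0 \<in> tensor_span (adj ` M)" "adj W0 o\<^sub>L W0 = id_blinfun"
    using tensor_span_isometry_ex [OF TRO_adj [OF M(1)] cl] id2 by (auto simp only: eq)
  have W0c: "W0 \<in> cblinfun" using W0(1) tensor_span_cblinfun [of "adj ` M"] Mc by auto
  \<comment> \<open>Passing to the co-isometry \<open>W\<close> places everything in the tensor span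
    of the single ternary ring \<open>M\<close>.\<close>
  define W where "W = adj W0"
  have W: "W \<in> tensor_span M"
    using tensor_span_adj [OF _ W0(1)] Mc by (auto simp: W_def adjadj)
  have Vc: "V \<in> cblinfun" and Wc: "W \<in> cblinfun" using tensor_span_cblinfun [OF Mc] V(1) W by auto
  have Wa: "adj W = W0" using W0c by (simp add: W_def)
  obtain J L :: "complex ell2 \<Rightarrow>\<^sub>L complex ell2" where JL: "J \<in> cblinfun" "L \<in> cblinfun"
    "adj J o\<^sub>L J = id_blinfun" "adj L o\<^sub>L L = id_blinfun" "(J o\<^sub>L adj J) + (L o\<^sub>L adj L) = id_blinfun"
    using cuntz_isometries_ex by blast
  define A where "A = op_tensor (id_blinfun :: 'a \<Rightarrow>\<^sub>L 'a)"
  define B where "B = op_tensor (id_blinfun :: 'b \<Rightarrow>\<^sub>L 'b)"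
  have A: "A k \<in> cblinfun" "adj (A k) = A (adj k)" if "k \<in> cblinfun" for k
    using that by (simp_all add: A_def op_tensor(1) adj_op_tensor)
  have B: "B k \<in> cblinfun" "adj (B k) = B (adj k)" if "k \<in> cblinfun" for k
    using that by (simp_all add: B_def op_tensor(1) adj_op_tensor)
  have AJL: "adj (A J) o\<^sub>L A J = id_blinfun" "adj (A L) o\<^sub>L A L = id_blinfun"
    "(A J o\<^sub>L adj (A J)) + (A L o\<^sub>L adj (A L)) = id_blinfun"
    using JL by (simp_all add: A_def adj_op_tensor op_tensor_compose op_tensor_id op_tensor_add_right [symmetric] cblinfun_compose)
  have BJL: "adj (B J) o\<^sub>L B J = id_blinfun" "adj (B L) o\<^sub>L B L = id_blinfun"
    "(B J o\<^sub>L adj (B J)) + (B L o\<^sub>L adj (B L)) = id_blinfun"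
    using JL by (simp_all add: B_def adj_op_tensor op_tensor_compose op_tensor_id op_tensor_add_right [symmetric] cblinfun_compose)
  define X where "X = V o\<^sub>L A J"
  define Y where "Y = id_blinfun - (V o\<^sub>L adj V) + (V o\<^sub>L A L o\<^sub>L adj V)"
  define X' where "X' = W0 o\<^sub>L B J"
  define Y' where "Y' = id_blinfun - (W0 o\<^sub>L adj W0) + (W0 o\<^sub>L B L o\<^sub>L adj W0)"
  note absorb = isometry_absorption [OF Vc A(1) [OF JL(1)] A(1) [OF JL(2)] V(2) AJL, folded X_def Y_def]
  note absorb' = isometry_absorption [OF W0c B(1) [OF JL(1)] B(1) [OF JL(2)] W0(2) BJL, folded X'_def Y'_def]
  have c: "X \<in> cblinfun" "Y \<in> cblinfun" "X' \<in> cblinfun" "Y' \<in> cblinfun"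
    unfolding X_def Y_def X'_def Y'_def
    by (intro cblinfun_add cblinfun_diff cblinfun_compose adj_cblinfun cblinfun_id Vc W0c A(1) B(1) JL)+
  have "unitary ((X o\<^sub>L adj Y') + (Y o\<^sub>L adj X'))"
    by (rule unitary_of_decompositions [OF c absorb absorb'])
  moreover have "(X o\<^sub>L adj Y') + (Y o\<^sub>L adj X') \<in> tensor_span M"
  proof -
    have XM: "X \<in> tensor_span M"
      unfolding X_def A_def by (rule tensor_span_amplification(1) [OF Mc V(1) JL(1)])
    have BLW: "B L o\<^sub>L W \<in> tensor_span M"
      unfolding B_def by (rule tensor_span_amplification(2) [OF Mc W JL(2)])
    have VAL: "V o\<^sub>L A L \<in> tensor_span M"
      unfolding A_def by (rule tensor_span_amplification(1) [OF Mc V(1) JL(2)])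
    define Z where "Z = B (adj J) o\<^sub>L W"
    have ZM: "Z \<in> tensor_span M"
      unfolding Z_def B_def by (rule tensor_span_amplification(2) [OF Mc W adj_cblinfun [OF JL(1)]])
    have Y'a: "adj Y' = id_blinfun - (adj W o\<^sub>L W) + (adj (B L o\<^sub>L W) o\<^sub>L W)"
      using W0c Wc JL(2)
      by (simp add: Y'_def adj_add adj_diff adj_compose cblinfun_compose cblinfun_add cblinfun_diff
          B(1) Wa W_def [symmetric] blinfun_compose_assoc)
    have X'a: "adj X' = Z"
      using W0c JL(1) by (simp add: X'_def Z_def adj_compose B W_def)
    \<comment> \<open>Multiplying out absorbs the identities contained in \<open>Y\<close> and
      \<open>Y'\<close>: every summand is \<open>X\<close>, \<open>Z\<close> or a triple product of
      members of \<open>tensor_span M\<close>.\<close>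
    have "X o\<^sub>L adj Y' = X - (X o\<^sub>L adj W o\<^sub>L W) + (X o\<^sub>L adj (B L o\<^sub>L W) o\<^sub>L W)"
      by (simp add: Y'a blinfun_compose_distribs blinfun_compose_assoc)
    moreover have "Y o\<^sub>L adj X' = Z - (V o\<^sub>L adj V o\<^sub>L Z) + (V o\<^sub>L A L o\<^sub>L adj V o\<^sub>L Z)"
      by (simp add: X'a Y_def blinfun_compose_distribs blinfun_compose_assoc)
    ultimately show ?thesis
      by (simp only:)
        (intro complex_vector.subspace_add [OF subspace_tensor_span]
          complex_vector.subspace_diff [OF subspace_tensor_span]
          tensor_span_triple [OF M(1)] XM W BLW VAL ZM V(1))
  qed
  ultimately show ?thesis by blast
qed

section \<open>Conjugation of the stabilizations\<close>

theorem theorem5p5: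
  fixes S :: "('h::chilbert_space \<Rightarrow>\<^sub>L 'h) set"
    and T :: "('k::chilbert_space \<Rightarrow>\<^sub>L 'k) set"
  assumes "operator_system S" and "operator_system T"
    and "strongly_TRO_equivalent S T"
  shows "\<exists>U :: 'h ell2 \<Rightarrow>\<^sub>L 'k ell2. unitary U \<and>
    stabilization T = (\<lambda>X. U o\<^sub>L X o\<^sub>L adj U) ` stabilization S"
proof -
  have S: "S \<subseteq> cblinfun" "closed S" and T: "T \<subseteq> cblinfun" "closed T"
    using assms(1,2) by (auto simp: operator_system_def)
  obtain M :: "('h \<Rightarrow>\<^sub>L 'k) set" where M: "TRO M"
    and id1: "id_blinfun \<in> closed_cspan {adj a o\<^sub>L b | a b. a \<in> M \<and> b \<in> M}"
    and id2: "id_blinfun \<in> closed_cspan {a o\<^sub>L adj b | a b. a \<in> M \<and> b \<in> M}"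
    and MST: "\<forall>a\<in>M. \<forall>s\<in>S. \<forall>b\<in>M. a o\<^sub>L s o\<^sub>L adj b \<in> T"
    and MTS: "\<forall>a\<in>M. \<forall>t\<in>T. \<forall>b\<in>M. adj a o\<^sub>L t o\<^sub>L b \<in> S"
    using assms(3) unfolding strongly_TRO_equivalent_def by (elim exE conjE) (rule that)
  \<comment> \<open>The frame construction needs a closed ternary ring. The inclusions relating
    \<open>M\<close> to \<open>S\<close> and \<open>T\<close> survive the closure because
    \<open>S\<close> and \<open>T\<close> are closed.\<close>
  define N where "N = closure M"
  have N: "TRO N" "closed N" unfolding N_def using TRO_closure [OF M] by simp_all
  have Nc: "N \<subseteq> cblinfun" using N(1) by (simp add: TRO_def)
  have MN: "M \<subseteq> N" unfolding N_def by (rule closure_subset)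
  have closure_adj: "\<exists>f. (\<forall>n::nat. f n \<in> M) \<and> f \<longlonglongrightarrow> a \<and> (\<lambda>n. adj (f n)) \<longlonglongrightarrow> adj a" if "a \<in> N" for a
  proof -
    obtain f where f: "\<And>n::nat. f n \<in> M" "f \<longlonglongrightarrow> a"
      using \<open>a \<in> N\<close> unfolding N_def closure_sequential by blast
    have "(\<lambda>n. adj (f n)) \<longlonglongrightarrow> adj a"
      using f(1) MN Nc that by (intro tendsto_adj f(2)) auto
    with f show ?thesis by blast
  qed
  have NST: "a o\<^sub>L s o\<^sub>L adj b \<in> T" if "a \<in> N" "s \<in> S" "b \<in> N" for a s b
  proof -
    obtain f where f: "\<And>n::nat. f n \<in> M" "f \<longlonglongrightarrow> a" using closure_adj [OF \<open>a \<in> N\<close>] by blast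
    obtain g where g: "\<And>n::nat. g n \<in> M" "(\<lambda>n. adj (g n)) \<longlonglongrightarrow> adj b"
      using closure_adj [OF \<open>b \<in> N\<close>] by blast
    have "(\<lambda>n. f n o\<^sub>L s o\<^sub>L adj (g n)) \<longlonglongrightarrow> (a o\<^sub>L s o\<^sub>L adj b)"
      by (intro bounded_bilinear.tendsto [OF bounded_bilinear_blinfun_compose] f g tendsto_const)
    then show ?thesis
      by (rule closed_sequentially [OF T(2), rotated]) (rule MST [rule_format, OF f(1) \<open>s \<in> S\<close> g(1)])
  qed
  have NTS: "adj a o\<^sub>L t o\<^sub>L b \<in> S" if "a \<in> N" "t \<in> T" "b \<in> N" for a t b
  proof -
    obtain f where f: "\<And>n::nat. f n \<in> M" "(\<lambda>n. adj (f n)) \<longlonglongrightarrow> adj a"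
      using closure_adj [OF \<open>a \<in> N\<close>] by blast
    obtain g where g: "\<And>n::nat. g n \<in> M" "g \<longlonglongrightarrow> b" using closure_adj [OF \<open>b \<in> N\<close>] by blast
    have "(\<lambda>n. adj (f n) o\<^sub>L t o\<^sub>L g n) \<longlonglongrightarrow> (adj a o\<^sub>L t o\<^sub>L b)"
      by (intro bounded_bilinear.tendsto [OF bounded_bilinear_blinfun_compose] f g tendsto_const)
    then show ?thesis
      by (rule closed_sequentially [OF S(2), rotated]) (rule MTS [rule_format, OF f(1) \<open>t \<in> T\<close> g(1)])
  qed
  obtain U where U: "U \<in> tensor_span N" "unitary U"
  proof -
    have "id_blinfun \<in> closed_cspan {adj a o\<^sub>L b | a b. a \<in> N \<and> b \<in> N}"
      by (rule subsetD [OF closed_cspan_mono id1]) (use MN in blast)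
    moreover have "id_blinfun \<in> closed_cspan {a o\<^sub>L adj b | a b. a \<in> N \<and> b \<in> N}"
      by (rule subsetD [OF closed_cspan_mono id2]) (use MN in blast)
    ultimately show thesis using tensor_span_unitary_ex [OF N] that by blast
  qed
  have Uc: "U \<in> cblinfun" and UU: "adj U o\<^sub>L U = id_blinfun" "U o\<^sub>L adj U = id_blinfun"
    using U(2) by (simp_all add: unitary_def)
  have 1: "U o\<^sub>L X o\<^sub>L adj U \<in> stabilization T" if "X \<in> stabilization S" for X
    by (rule stabilization_conj [OF Nc S(1) NST U(1) that])
  have 2: "adj U o\<^sub>L X o\<^sub>L U \<in> stabilization S" if X: "X \<in> stabilization T" for X
  proof -
    have "adj U o\<^sub>L X o\<^sub>L adj (adj U) \<in> stabilization S"
    proof (rule stabilization_conj [OF _ T(1) _ tensor_span_adj [OF Nc U(1)] X])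
      show "adj ` N \<subseteq> cblinfun" using Nc by auto
      show "a o\<^sub>L t o\<^sub>L adj b \<in> S" if "a \<in> adj ` N" "t \<in> T" "b \<in> adj ` N" for a t b
      proof -
        obtain a' b' where "a = adj a'" "a' \<in> N" "b = adj b'" "b' \<in> N" using \<open>a \<in> adj ` N\<close> \<open>b \<in> adj ` N\<close> by blast
        moreover from this have "adj b = b'" using Nc by auto
        ultimately show ?thesis using NTS \<open>t \<in> T\<close> by simp
      qed
    qed
    then show ?thesis using Uc by simp
  qed
  have "X \<in> (\<lambda>X. U o\<^sub>L X o\<^sub>L adj U) ` stabilization S" if "X \<in> stabilization T" for X
  proof (rule image_eqI [OF _ 2 [OF that]])
    have "U o\<^sub>L (adj U o\<^sub>L X o\<^sub>L U) o\<^sub>L adj U = (U o\<^sub>L adj U) o\<^sub>L X o\<^sub>L (U o\<^sub>L adj U)"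
      by (simp only: blinfun_compose_assoc)
    then show "X = U o\<^sub>L (adj U o\<^sub>L X o\<^sub>L U) o\<^sub>L adj U" by (simp add: UU)
  qed
  with 1 have "stabilization T = (\<lambda>X. U o\<^sub>L X o\<^sub>L adj U) ` stabilization S" by blast
  with U(2) show ?thesis by blast
qed

end
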